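(* Let $G$ be a finite-dimensional Lie group with Lie algebra $\mathfrak{g}$ and let $g$ be a left-invariant Riemannian metric on $G$. Then $g$ is a Schouten like metric if and only if $g$ is an algebraic Schouten soliton.
   Context: Let $ric_g$ denote the Ricci curvature tensor of $(G,g)$ (for the Levi-Civita connection), viewed as a symmetric bilinear form on $\mathfrak{g}$, let $Ric_g:\mathfrak{g}\to\mathfrak{g}$ be the Ricci operator defined by $ric_g(u,v)=g(Ric_g(u),v)$ for all $u,v\in\mathfrak{g}$, let $s$ be the scalar curvature of $(G,g)$, and let $Der(\mathfrak{g})$ be the set of derivations of $\mathfrak{g}$. A derivation $D\in Der(\mathfrak{g})$ is symmetric with respect to $g$ if $g(D(u),v)=g(u,D(v))$ for all $u,v\in\mathfrak{g}$. The metric $g$ is called a Schouten like metric if there are real numbers $\lambda_0,c$ and a derivation $D$ of $\mathfrak{g}$, symmetric with respect to $g$, such that $ric_g(X,Y)=(s\lambda_0+c)\,g(X,Y)+g(D(X),Y)$ for all $X,Y\in\mathfrak{g}$. The metric $g$ is called an algebraic Schouten soliton (associated with the Levi-Civita connection) if there are real numbers $\lambda_0,c$ such that $Ric_g-(s\lambda_0+c)\,\mathrm{Id}\in Der(\mathfrak{g})$. *)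

theory Defs
  imports "HOL-Analysis.Analysis" "HOL-Library.Function_Algebras"
begin

text \<open>Tangent vectors are real functionals on functions and vector fields are families of tangent
  vectors, so both live in function spaces with the pointwise vector space structure.\<close>

instantiation "fun" :: (type, real_vector) real_vector
begin

definition scaleR_fun :: "real \<Rightarrow> ('a \<Rightarrow> 'b) \<Rightarrow> 'a \<Rightarrow> 'b" where
  "scaleR_fun c f = (\<lambda>x. c *\<^sub>R f x)"

instance
  by standard (auto simp: scaleR_fun_def plus_fun_def scaleR_add_right scaleR_add_left)

end


subsection \<open>Linear algebra on subspaces\<close>

definition linear_on :: "'a::real_vector set \<Rightarrow> ('a \<Rightarrow> 'b::real_vector) \<Rightarrow> bool" where
  "linear_on V f \<longleftrightarrow>
     (\<forall>x\<in>V. \<forall>y\<in>V. f (x + y) = f x + f y) \<and> (\<forall>c. \<forall>x\<in>V. f (c *\<^sub>R x) = c *\<^sub>R f x)"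

definition inner_product_on :: "'a::real_vector set \<Rightarrow> ('a \<Rightarrow> 'a \<Rightarrow> real) \<Rightarrow> bool" where
  "inner_product_on V b \<longleftrightarrow>
     (\<forall>y\<in>V. linear_on V (\<lambda>x. b x y)) \<and>
     (\<forall>x\<in>V. \<forall>y\<in>V. b x y = b y x) \<and>
     (\<forall>x\<in>V. x \<noteq> 0 \<longrightarrow> b x x > 0)"

definition some_basis :: "'a::real_vector set \<Rightarrow> 'a set" where
  "some_basis V = (SOME B. independent B \<and> span B = V)"

definition trace_on :: "'a::real_vector set \<Rightarrow> ('a \<Rightarrow> 'a) \<Rightarrow> real" where
  "trace_on V T = (\<Sum>b\<in>some_basis V. representation (some_basis V) (T b) b)"


subsection \<open>Smooth manifolds and Lie groups\<close>

text \<open>These two notions are meant for open \<open>S\<close> in a finite-dimensional normed space, where continuity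
  of all iterated directional derivatives amounts to \<open>C\<^sup>k\<close>-smoothness.\<close>

primrec k_smooth_on ::
    "nat \<Rightarrow> 'v::real_normed_vector set \<Rightarrow> ('v \<Rightarrow> 'w::real_normed_vector) \<Rightarrow> bool" where
  "k_smooth_on 0 S f \<longleftrightarrow> continuous_on S f"
| "k_smooth_on (Suc k) S f \<longleftrightarrow>
     (\<forall>x\<in>S. f differentiable (at x)) \<and>
     (\<forall>v. k_smooth_on k S (\<lambda>x. frechet_derivative f (at x) v))"

definition smooth_on :: "'v::real_normed_vector set \<Rightarrow> ('v \<Rightarrow> 'w::real_normed_vector) \<Rightarrow> bool" where
  "smooth_on S f \<longleftrightarrow> (\<forall>k. k_smooth_on k S f)"

type_synonym ('a, 'v) atlas = "('a set \<times> ('a \<Rightarrow> 'v)) set"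

definition smooth_atlas :: "('a::topological_space, 'v::real_normed_vector) atlas \<Rightarrow> bool" where
  "smooth_atlas A \<longleftrightarrow>
     (\<forall>(U, \<phi>)\<in>A. open U \<and> open (\<phi> ` U) \<and> homeomorphism U (\<phi> ` U) \<phi> (inv_into U \<phi>)) \<and>
     (\<Union>(U, \<phi>)\<in>A. U) = UNIV \<and>
     (\<forall>(U, \<phi>)\<in>A. \<forall>(V, \<psi>)\<in>A. smooth_on (\<phi> ` (U \<inter> V)) (\<psi> \<circ> inv_into U \<phi>))"

definition prod_atlas :: "('a, 'v) atlas \<Rightarrow> ('b, 'w) atlas \<Rightarrow> ('a \<times> 'b, 'v \<times> 'w) atlas" where
  "prod_atlas A B = {(U \<times> V, map_prod \<phi> \<psi>) | U \<phi> V \<psi>. (U, \<phi>) \<in> A \<and> (V, \<psi>) \<in> B}"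

definition smooth_map :: "('a::topological_space, 'v::real_normed_vector) atlas \<Rightarrow>
    ('b::topological_space, 'w::real_normed_vector) atlas \<Rightarrow> ('a \<Rightarrow> 'b) \<Rightarrow> bool" where
  "smooth_map A B F \<longleftrightarrow> continuous_on UNIV F \<and>
     (\<forall>(U, \<phi>)\<in>A. \<forall>(V, \<psi>)\<in>B. smooth_on (\<phi> ` (U \<inter> F -` V)) (\<psi> \<circ> F \<circ> inv_into U \<phi>))"

definition smooth_functions ::
    "('a::topological_space, 'v::real_normed_vector) atlas \<Rightarrow> ('a \<Rightarrow> real) set" where
  "smooth_functions A = {f. \<forall>(U, \<phi>)\<in>A. smooth_on (\<phi> ` U) (f \<circ> inv_into U \<phi>)}"

text \<open>The model space is a finite-dimensional real normed space rather than a Euclidean space type,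
  because types of class \<open>euclidean_space\<close> have positive dimension.\<close>

locale lie_group = group mul one iv
  for mul :: "'a::{t2_space, second_countable_topology} \<Rightarrow> 'a \<Rightarrow> 'a"
    and one :: 'a and iv :: "'a \<Rightarrow> 'a" +
  fixes A :: "('a, 'v::real_normed_vector) atlas"
  assumes finite_dimensional_model: "\<exists>B :: 'v set. finite B \<and> span B = UNIV"
    and smooth_atlas: "smooth_atlas A"
    and smooth_mult: "smooth_map (prod_atlas A A) A (\<lambda>(p, q). mul p q)"
    and smooth_inverse: "smooth_map A A iv"


subsection \<open>Tangent vectors and vector fields\<close>

type_synonym 'a tangent = "('a \<Rightarrow> real) \<Rightarrow> real"
type_synonym 'a vfield = "'a \<Rightarrow> 'a tangent"

text \<open>Tangent vectors at \<open>p\<close> are the derivations at \<open>p\<close> of the algebra of smooth functions. The value on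
  a function that is not smooth is set to 0, so that a tangent vector is determined by its
  values on smooth functions.\<close>

definition tangent_space ::
    "('a::topological_space, 'v::real_normed_vector) atlas \<Rightarrow> 'a \<Rightarrow> 'a tangent set" where
  "tangent_space A p = {v. linear_on (smooth_functions A) v \<and>
     (\<forall>f\<in>smooth_functions A. \<forall>h\<in>smooth_functions A. v (f * h) = f p * v h + h p * v f) \<and>
     (\<forall>f. f \<notin> smooth_functions A \<longrightarrow> v f = 0)}"

definition differential ::
    "('a::topological_space, 'v::real_normed_vector) atlas \<Rightarrow> ('a \<Rightarrow> 'a) \<Rightarrow> 'a tangent \<Rightarrow> 'a tangent"
  where "differential A F v = (\<lambda>f. if f \<in> smooth_functions A then v (f \<circ> F) else 0)"

definition vector_fields ::
    "('a::topological_space, 'v::real_normed_vector) atlas \<Rightarrow> 'a vfield set" where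
  "vector_fields A = {X. (\<forall>p. X p \<in> tangent_space A p) \<and>
     (\<forall>f\<in>smooth_functions A. (\<lambda>p. X p f) \<in> smooth_functions A)}"

definition lie_bracket :: "('a::topological_space, 'v::real_normed_vector) atlas \<Rightarrow>
    'a vfield \<Rightarrow> 'a vfield \<Rightarrow> 'a vfield" where
  "lie_bracket A X Y = (\<lambda>p f. if f \<in> smooth_functions A
     then X p (\<lambda>q. Y q f) - Y p (\<lambda>q. X q f) else 0)"

definition lie_algebra :: "('a \<Rightarrow> 'a \<Rightarrow> 'a) \<Rightarrow>
    ('a::topological_space, 'v::real_normed_vector) atlas \<Rightarrow> 'a vfield set" where
  "lie_algebra mul A =
     {X \<in> vector_fields A. \<forall>a p. X (mul a p) = differential A (mul a) (X p)}"

definition derivations :: "('a \<Rightarrow> 'a \<Rightarrow> 'a) \<Rightarrow>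
    ('a::topological_space, 'v::real_normed_vector) atlas \<Rightarrow> ('a vfield \<Rightarrow> 'a vfield) set" where
  "derivations mul A = {D. D ` lie_algebra mul A \<subseteq> lie_algebra mul A \<and>
     linear_on (lie_algebra mul A) D \<and>
     (\<forall>X\<in>lie_algebra mul A. \<forall>Y\<in>lie_algebra mul A.
        D (lie_bracket A X Y) = lie_bracket A (D X) Y + lie_bracket A X (D Y))}"


subsection \<open>Left-invariant metrics and curvature\<close>

type_synonym 'a metric_tensor = "'a \<Rightarrow> 'a tangent \<Rightarrow> 'a tangent \<Rightarrow> real"

definition riemannian_metric :: "('a::topological_space, 'v::real_normed_vector) atlas \<Rightarrow>
    'a metric_tensor \<Rightarrow> bool" where
  "riemannian_metric A g \<longleftrightarrow>
     (\<forall>p. inner_product_on (tangent_space A p) (g p)) \<and>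
     (\<forall>X\<in>vector_fields A. \<forall>Y\<in>vector_fields A. (\<lambda>p. g p (X p) (Y p)) \<in> smooth_functions A)"

definition left_invariant :: "('a \<Rightarrow> 'a \<Rightarrow> 'a) \<Rightarrow>
    ('a::topological_space, 'v::real_normed_vector) atlas \<Rightarrow> 'a metric_tensor \<Rightarrow> bool" where
  "left_invariant mul A g \<longleftrightarrow>
     (\<forall>a p. \<forall>u\<in>tangent_space A p. \<forall>v\<in>tangent_space A p.
        g (mul a p) (differential A (mul a) u) (differential A (mul a) v) = g p u v)"

type_synonym 'a connection = "'a vfield \<Rightarrow> 'a vfield \<Rightarrow> 'a vfield"

definition affine_connection :: "('a::topological_space, 'v::real_normed_vector) atlas \<Rightarrow>
    'a connection \<Rightarrow> bool" where
  "affine_connection A nabla \<longleftrightarrow>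
     (\<forall>X\<in>vector_fields A. \<forall>Y\<in>vector_fields A. nabla X Y \<in> vector_fields A) \<and>
     (\<forall>X\<in>vector_fields A. \<forall>Y\<in>vector_fields A. \<forall>Z\<in>vector_fields A.
        nabla (X + Y) Z = nabla X Z + nabla Y Z \<and> nabla X (Y + Z) = nabla X Y + nabla X Z) \<and>
     (\<forall>f\<in>smooth_functions A. \<forall>X\<in>vector_fields A. \<forall>Y\<in>vector_fields A.
        nabla (\<lambda>p. f p *\<^sub>R X p) Y = (\<lambda>p. f p *\<^sub>R nabla X Y p) \<and>
        nabla X (\<lambda>p. f p *\<^sub>R Y p) = (\<lambda>p. X p f *\<^sub>R Y p + f p *\<^sub>R nabla X Y p))"

definition levi_civita_connection :: "('a::topological_space, 'v::real_normed_vector) atlas \<Rightarrow>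
    'a metric_tensor \<Rightarrow> 'a connection \<Rightarrow> bool" where
  "levi_civita_connection A g nabla \<longleftrightarrow>
     affine_connection A nabla \<and>
     (\<forall>X\<in>vector_fields A. \<forall>Y\<in>vector_fields A. nabla X Y - nabla Y X = lie_bracket A X Y) \<and>
     (\<forall>X\<in>vector_fields A. \<forall>Y\<in>vector_fields A. \<forall>Z\<in>vector_fields A. \<forall>p.
        X p (\<lambda>q. g q (Y q) (Z q)) = g p (nabla X Y p) (Z p) + g p (Y p) (nabla X Z p))"

definition curvature :: "('a::topological_space, 'v::real_normed_vector) atlas \<Rightarrow>
    'a connection \<Rightarrow> 'a vfield \<Rightarrow> 'a vfield \<Rightarrow> 'a vfield \<Rightarrow> 'a vfield" where
  "curvature A nabla X Y Z =
     nabla X (nabla Y Z) - nabla Y (nabla X Z) - nabla (lie_bracket A X Y) Z"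

text \<open>The value of a left-invariant metric on two left-invariant vector fields is a constant function;
  it is evaluated at the identity.\<close>

definition metric_form :: "'a \<Rightarrow> 'a metric_tensor \<Rightarrow> 'a vfield \<Rightarrow> 'a vfield \<Rightarrow> real" where
  "metric_form one g X Y = g one (X one) (Y one)"

text \<open>For left-invariant fields the curvature of a left-invariant metric is left-invariant, and
  evaluation at any point \<open>p\<close> is an isomorphism from the Lie algebra to the tangent space at \<open>p\<close>.
  Hence the trace over the tangent space that defines the Ricci tensor is a trace over the Lie
  algebra.\<close>

definition ricci_form :: "('a \<Rightarrow> 'a \<Rightarrow> 'a) \<Rightarrow>
    ('a::topological_space, 'v::real_normed_vector) atlas \<Rightarrow> 'a connection \<Rightarrow>
    'a vfield \<Rightarrow> 'a vfield \<Rightarrow> real" where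
  "ricci_form mul A nabla X Y = trace_on (lie_algebra mul A) (\<lambda>Z. curvature A nabla Z X Y)"

definition ricci_operator :: "('a \<Rightarrow> 'a \<Rightarrow> 'a) \<Rightarrow> 'a \<Rightarrow>
    ('a::topological_space, 'v::real_normed_vector) atlas \<Rightarrow> 'a metric_tensor \<Rightarrow> 'a connection \<Rightarrow>
    'a vfield \<Rightarrow> 'a vfield" where
  "ricci_operator mul one A g nabla X = (THE Z. Z \<in> lie_algebra mul A \<and>
     (\<forall>Y\<in>lie_algebra mul A. ricci_form mul A nabla X Y = metric_form one g Z Y))"

definition scalar_curvature :: "('a \<Rightarrow> 'a \<Rightarrow> 'a) \<Rightarrow> 'a \<Rightarrow>
    ('a::topological_space, 'v::real_normed_vector) atlas \<Rightarrow> 'a metric_tensor \<Rightarrow> 'a connection \<Rightarrow>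
    real" where
  "scalar_curvature mul one A g nabla =
     trace_on (lie_algebra mul A) (ricci_operator mul one A g nabla)"


subsection \<open>Schouten like metrics and algebraic Schouten solitons\<close>

definition symmetric_wrt_metric :: "('a \<Rightarrow> 'a \<Rightarrow> 'a) \<Rightarrow> 'a \<Rightarrow>
    ('a::topological_space, 'v::real_normed_vector) atlas \<Rightarrow> 'a metric_tensor \<Rightarrow>
    ('a vfield \<Rightarrow> 'a vfield) \<Rightarrow> bool" where
  "symmetric_wrt_metric mul one A g D \<longleftrightarrow>
     (\<forall>X\<in>lie_algebra mul A. \<forall>Y\<in>lie_algebra mul A.
        metric_form one g (D X) Y = metric_form one g X (D Y))"

definition schouten_like_metric :: "('a \<Rightarrow> 'a \<Rightarrow> 'a) \<Rightarrow> 'a \<Rightarrow>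
    ('a::topological_space, 'v::real_normed_vector) atlas \<Rightarrow> 'a metric_tensor \<Rightarrow> 'a connection \<Rightarrow>
    bool" where
  "schouten_like_metric mul one A g nabla \<longleftrightarrow>
     (\<exists>l0 c. \<exists>D\<in>derivations mul A. symmetric_wrt_metric mul one A g D \<and>
        (\<forall>X\<in>lie_algebra mul A. \<forall>Y\<in>lie_algebra mul A.
           ricci_form mul A nabla X Y =
             (scalar_curvature mul one A g nabla * l0 + c) * metric_form one g X Y +
             metric_form one g (D X) Y))"

definition algebraic_schouten_soliton :: "('a \<Rightarrow> 'a \<Rightarrow> 'a) \<Rightarrow> 'a \<Rightarrow>
    ('a::topological_space, 'v::real_normed_vector) atlas \<Rightarrow> 'a metric_tensor \<Rightarrow> 'a connection \<Rightarrow>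
    bool" where
  "algebraic_schouten_soliton mul one A g nabla \<longleftrightarrow>
     (\<exists>l0 c. (\<lambda>X. ricci_operator mul one A g nabla X -
        (scalar_curvature mul one A g nabla * l0 + c) *\<^sub>R X) \<in> derivations mul A)"

end

(* The Ricci operator represents the Ricci form, so the two notions differ only in that a Schouten
   like metric requires the derivation to be symmetric. This is automatic because the Ricci form is
   symmetric: Z |-> R(Z,X)Y and Z |-> R(Z,Y)X are adjoint by the pair symmetry of the curvature tensor
   and hence have equal traces. What has to be established is that everything takes place inside the
   Lie algebra: by the Koszul formula the Levi-Civita connection commutes with left translations, so
   it maps left-invariant fields to left-invariant fields. *)

theory Submission
  imports Defs
begin

text \<open>Translating vector fields presupposes that \<open>f\<close> composed with a left
  translation is smooth again, while the Lie group axioms give smoothness of the multiplication on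
  the product, in product charts. Freezing one factor and composing with \<open>f\<close> calls for
  a chain rule for iterated directional derivatives, and thus for continuous coordinate functionals
  on the model space, which is a bare normed space with a finite spanning set. This is the origin of
  the analysis that precedes the geometry. On the geometric side, left invariance is expressed as
  being fixed by the pullback operators \<open>pull a\<close>, so that whatever commutes with them
  preserves the Lie algebra. The scalar curvature enters merely as a number: the same pair of
  constants serves in both directions.\<close>

subsection \<open>Coordinates in a finite-dimensional normed space\<close>

text \<open>If the distance were 0, some sequence in the span would converge to \<open>x\<close>.
  The bound \<open>K\<close> makes each of its coefficient sequences Cauchy in the reals, and the
  limits of the coefficients would exhibit \<open>x\<close> as an element of the span.\<close>

lemma finite_span_dist_pos:
  fixes B :: "'v::real_normed_vector set"
  assumes "finite B" and "x \<notin> span B" and "K > 0"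
    and K: "\<And>c. (\<Sum>b\<in>B. \<bar>c b\<bar>) \<le> K * norm (\<Sum>b\<in>B. c b *\<^sub>R b)"
  shows "\<exists>d>0. \<forall>y\<in>span B. d \<le> norm (x - y)"
proof (rule ccontr)
  assume "\<not> ?thesis"
  then have "\<forall>d>0. \<exists>y\<in>span B. norm (x - y) < d"
    by (meson not_le)
  then have "\<forall>n. \<exists>y\<in>span B. norm (x - y) < 1 / real (Suc n)"
    by simp
  then obtain y where y: "\<And>n. y n \<in> span B" "\<And>n. norm (x - y n) < 1 / real (Suc n)"
    by metis
  have "\<forall>n. \<exists>c. y n = (\<Sum>b\<in>B. c b *\<^sub>R b)"
    using y(1) unfolding span_finite[OF assms(1)] by auto
  then obtain c where c: "\<And>n. y n = (\<Sum>b\<in>B. c n b *\<^sub>R b)"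
    by metis
  have lim: "y \<longlonglongrightarrow> x"
  proof (rule metric_LIMSEQ_I)
    fix r :: real assume "r > 0"
    then obtain N where N: "1 / real (Suc N) < r"
      using nat_approx_posE by blast
    have "dist (y n) x < r" if "n \<ge> N" for n
    proof -
      have "1 / real (Suc n) \<le> 1 / real (Suc N)"
        using that by (simp add: frac_le)
      then show ?thesis
        using y(2)[of n] N by (simp add: dist_norm norm_minus_commute)
    qed
    then show "\<exists>no. \<forall>n\<ge>no. dist (y n) x < r"
      by (intro exI[of _ N] allI impI)
  qed
  have "convergent (\<lambda>n. c n b)" if "b \<in> B" for b
  proof -
    have le: "\<bar>c m b - c n b\<bar> \<le> K * norm (y m - y n)" for m n
    proof -
      have "\<bar>c m b - c n b\<bar> \<le> (\<Sum>b\<in>B. \<bar>c m b - c n b\<bar>)"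
        using assms(1) that by (intro member_le_sum) auto
      also have "\<dots> \<le> K * norm (y m - y n)"
        using K[of "\<lambda>b. c m b - c n b"]
        by (simp add: c scaleR_left_diff_distrib sum_subtractf)
      finally show ?thesis .
    qed
    have "Cauchy (\<lambda>n. c n b)"
    proof (rule metric_CauchyI)
      fix e :: real assume "e > 0"
      then have "e / K > 0" using assms(3) by simp
      then obtain M where "\<forall>m\<ge>M. \<forall>n\<ge>M. dist (y m) (y n) < e / K"
        using LIMSEQ_imp_Cauchy[OF lim] unfolding Cauchy_def by blast
      then have "\<forall>m\<ge>M. \<forall>n\<ge>M. K * norm (y m - y n) < e"
        using assms(3) by (simp add: dist_norm field_simps)
      then show "\<exists>M. \<forall>m\<ge>M. \<forall>n\<ge>M. dist (c m b) (c n b) < e"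
        using le by (metis dist_real_def le_less_trans)
    qed
    then show ?thesis
      by (simp add: Cauchy_convergent)
  qed
  then have "\<And>b. b \<in> B \<Longrightarrow> (\<lambda>n. c n b) \<longlonglongrightarrow> lim (\<lambda>n. c n b)"
    by (simp add: convergent_LIMSEQ_iff)
  then have "(\<lambda>n. \<Sum>b\<in>B. c n b *\<^sub>R b) \<longlonglongrightarrow> (\<Sum>b\<in>B. lim (\<lambda>n. c n b) *\<^sub>R b)"
    by (intro tendsto_sum tendsto_scaleR tendsto_const)
  then have "x = (\<Sum>b\<in>B. lim (\<lambda>n. c n b) *\<^sub>R b)"
    using lim LIMSEQ_unique unfolding c[abs_def] by blast
  moreover have "(\<Sum>b\<in>B. lim (\<lambda>n. c n b) *\<^sub>R b) \<in> span B"
    by (intro span_sum span_scale span_base)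
  ultimately show False
    using assms(2) by simp
qed

text \<open>Comparison of the coefficient norm with the given norm, by induction on the basis: the
  new vector has positive distance \<open>d\<close> from the span of the old ones, which bounds its
  coefficient, and the induction hypothesis bounds the others.\<close>

lemma coefficients_bounded:
  fixes B :: "'v::real_normed_vector set"
  assumes "finite B" and "independent B"
  shows "\<exists>K>0. \<forall>c. (\<Sum>b\<in>B. \<bar>c b\<bar>) \<le> K * norm (\<Sum>b\<in>B. c b *\<^sub>R b)"
  using assms
proof (induction B)
  case empty
  then show ?case by (auto intro: exI[of _ 1])
next
  case (insert x B)
  then have x: "x \<notin> span B" and ind: "independent B"
    by (auto simp: independent_insert)
  obtain K where K: "K > 0" "\<And>c. (\<Sum>b\<in>B. \<bar>c b\<bar>) \<le> K * norm (\<Sum>b\<in>B. c b *\<^sub>R b)"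
    using insert.IH[OF ind] by blast
  obtain d where d: "d > 0" "\<And>y. y \<in> span B \<Longrightarrow> d \<le> norm (x - y)"
    using finite_span_dist_pos[OF insert.hyps(1) x K] by blast
  \<comment> \<open>With \<open>N\<close> the norm of the combination, the estimates below are
    \<open>\<bar>c x\<bar> \<le> N / d\<close> and \<open>norm y \<le> N + N / d * norm x\<close>.
    Adding the first to \<open>K\<close> times the second gives \<open>L * N\<close>.\<close>
  define L where "L = 1 / d + K + K * norm x / d"
  have "(\<Sum>b\<in>insert x B. \<bar>c b\<bar>) \<le> L * norm (\<Sum>b\<in>insert x B. c b *\<^sub>R b)" for c
  proof -
    define y where "y = (\<Sum>b\<in>B. c b *\<^sub>R b)"
    define N where "N = norm (c x *\<^sub>R x + y)"
    have "\<bar>c x\<bar> * d \<le> N"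
    proof (cases "c x = 0")
      case False
      \<comment> \<open>Dividing by \<open>c x\<close> turns the combination into the difference of
        \<open>x\<close> and a vector of the span, to which the distance \<open>d\<close>
        applies.\<close>
      have "- (1 / c x) *\<^sub>R y \<in> span B"
        unfolding y_def by (intro span_scale span_sum span_base)
      then have "\<bar>c x\<bar> * d \<le> \<bar>c x\<bar> * norm (x - (- (1 / c x) *\<^sub>R y))"
        by (intro mult_left_mono d(2)) auto
      also have "\<dots> = norm (c x *\<^sub>R (x - (- (1 / c x) *\<^sub>R y)))"
        by simp
      also have "c x *\<^sub>R (x - (- (1 / c x) *\<^sub>R y)) = c x *\<^sub>R x + y"
        using False by (simp add: scaleR_add_right)
      finally show ?thesis by (simp add: N_def)
    qed (simp add: N_def)
    then have t: "\<bar>c x\<bar> \<le> N / d"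
      using d(1) by (simp add: field_simps)
    have "norm y \<le> N + \<bar>c x\<bar> * norm x"
      unfolding N_def using norm_triangle_ineq4[of "c x *\<^sub>R x + y" "c x *\<^sub>R x"] by simp
    also have "\<dots> \<le> N + N / d * norm x"
      using mult_right_mono[OF t, of "norm x"] by simp
    finally have "K * norm y \<le> K * (N + N / d * norm x)"
      using K(1) by simp
    then have "\<bar>c x\<bar> + (\<Sum>b\<in>B. \<bar>c b\<bar>) \<le> N / d + K * (N + N / d * norm x)"
      using K(2)[of c] t unfolding y_def by linarith
    also have "\<dots> = L * N"
      by (simp add: L_def field_simps)
    finally show ?thesis
      using insert.hyps by (simp add: N_def y_def)
  qed
  moreover have "L > 0"
    using K(1) d(1) by (simp add: L_def add_pos_nonneg)
  ultimately show ?case by blast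
qed

lemma bounded_linear_representation:
  fixes B :: "'v::real_normed_vector set"
  assumes "finite B" and "independent B" and "span B = UNIV" and "b \<in> B"
  shows "bounded_linear (\<lambda>v. representation B v b)"
proof -
  obtain K where K: "\<And>c. (\<Sum>b\<in>B. \<bar>c b\<bar>) \<le> K * norm (\<Sum>b\<in>B. c b *\<^sub>R b)"
    using coefficients_bounded[OF assms(1,2)] by blast
  show ?thesis
  proof (rule bounded_linear_intro)
    fix x y :: 'v and r :: real
    show "representation B (x + y) b = representation B x b + representation B y b"
      using assms by (simp add: real_vector.representation_add)
    show "representation B (r *\<^sub>R x) b = r *\<^sub>R representation B x b"
      using assms by (simp add: real_vector.representation_scale)
    have "\<bar>representation B x b\<bar> \<le> (\<Sum>b\<in>B. \<bar>representation B x b\<bar>)"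
      using assms by (intro member_le_sum) auto
    also have "\<dots> \<le> K * norm x"
      using K[of "representation B x"] assms by (simp add: real_vector.sum_representation_eq)
    finally show "norm (representation B x b) \<le> norm x * K"
      by (simp add: mult.commute)
  qed
qed


subsection \<open>Calculus of smooth maps\<close>

lemma k_smooth_on_cong:
  assumes "open S" and "\<And>x. x \<in> S \<Longrightarrow> f x = h x" and "k_smooth_on k S f"
  shows "k_smooth_on k S h"
  using assms(2,3)
proof (induction k arbitrary: f h)
  case 0
  then show ?case by (simp cong: continuous_on_cong)
next
  case (Suc k)
  have D: "(h has_derivative frechet_derivative f (at x)) (at x)" if "x \<in> S" for x
  proof (rule has_derivative_transform_within_open[OF _ assms(1) that])
    show "(f has_derivative frechet_derivative f (at x)) (at x)"
      using Suc.prems(2) that by (simp add: frechet_derivative_works)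
  qed (rule Suc.prems(1))
  then have eq: "frechet_derivative f (at x) v = frechet_derivative h (at x) v" if "x \<in> S" for x v
    using that frechet_derivative_at by metis
  have "k_smooth_on k S (\<lambda>x. frechet_derivative h (at x) v)" for v
    by (rule Suc.IH[OF eq]) (use Suc.prems(2) in auto)
  then show ?case
    using D by (auto simp: differentiable_def)
qed

text \<open>Allows an explicit derivative in place of the one chosen by
  \<open>frechet_derivative\<close>; on an open set the two agree.\<close>

lemma k_smooth_on_SucI:
  assumes "open S" and "\<And>x. x \<in> S \<Longrightarrow> (f has_derivative f' x) (at x)"
    and "\<And>v. k_smooth_on k S (\<lambda>x. f' x v)"
  shows "k_smooth_on (Suc k) S f"
proof -
  have eq: "f' x v = frechet_derivative f (at x) v" if "x \<in> S" for x v
    using frechet_derivative_at[OF assms(2)[OF that]] by metis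
  have "k_smooth_on k S (\<lambda>x. frechet_derivative f (at x) v)" for v
    by (rule k_smooth_on_cong[OF assms(1) eq assms(3)])
  then show ?thesis
    using assms(2) by (auto simp: differentiable_def)
qed

lemma k_smooth_on_SucD:
  assumes "k_smooth_on (Suc k) S f"
  shows "\<And>x. x \<in> S \<Longrightarrow> (f has_derivative frechet_derivative f (at x)) (at x)"
    and "\<And>v. k_smooth_on k S (\<lambda>x. frechet_derivative f (at x) v)"
proof -
  show "(f has_derivative frechet_derivative f (at x)) (at x)" if "x \<in> S" for x
    using assms that by (intro frechet_derivative_works[THEN iffD1]) simp
  show "k_smooth_on k S (\<lambda>x. frechet_derivative f (at x) v)" for v
    using assms by simp
qed

lemma k_smooth_on_Suc_imp: "k_smooth_on (Suc k) S f \<Longrightarrow> k_smooth_on k S f"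
proof (induction k arbitrary: f)
  case 0
  then show ?case
    by (auto intro!: continuous_at_imp_continuous_on differentiable_imp_continuous_within)
qed auto

text \<open>Derivatives are taken in the full space at each point, so a neighbourhood
  \<open>T\<close> may even leave \<open>S\<close>. Locality is needed because a translation maps
  different parts of one chart into different charts.\<close>

lemma k_smooth_on_local:
  assumes "\<And>x. x \<in> S \<Longrightarrow> \<exists>T. open T \<and> x \<in> T \<and> k_smooth_on k T f"
  shows "k_smooth_on k S f"
  using assms
proof (induction k arbitrary: f)
  case 0
  have "isCont f x" if "x \<in> S" for x
    using 0[OF that] by (auto simp: continuous_on_eq_continuous_at)
  then show ?case
    by (simp add: continuous_at_imp_continuous_on)
next
  case (Suc k)
  have "\<exists>T. open T \<and> x \<in> T \<and> k_smooth_on k T (\<lambda>x. frechet_derivative f (at x) v)"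
    if "x \<in> S" for x v
    using Suc.prems[OF that] by auto
  moreover have "f differentiable at x" if "x \<in> S" for x
    using Suc.prems[OF that] by auto
  ultimately show ?case
    using Suc.IH by simp
qed

lemma k_smooth_on_const: "k_smooth_on k S (\<lambda>x. c)"
  by (induction k arbitrary: c) (auto simp: frechet_derivative_const)

lemma k_smooth_on_add:
  assumes "open S" and "k_smooth_on k S f" and "k_smooth_on k S h"
  shows "k_smooth_on k S (\<lambda>x. f x + h x)"
  using assms(2,3)
proof (induction k arbitrary: f h)
  case 0
  then show ?case by (simp add: continuous_on_add)
next
  case (Suc k)
  note D = k_smooth_on_SucD[OF Suc.prems(1)] k_smooth_on_SucD[OF Suc.prems(2)]
  show ?case
    by (rule k_smooth_on_SucI[OF assms(1) has_derivative_add[OF D(1) D(3)]])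
      (assumption, assumption, rule Suc.IH[OF D(2,4)])
qed

lemma k_smooth_on_sum:
  assumes "open S" and "\<And>i. i \<in> I \<Longrightarrow> k_smooth_on k S (f i)"
  shows "k_smooth_on k S (\<lambda>x. \<Sum>i\<in>I. f i x)"
  using assms(2)
proof (induction I rule: infinite_finite_induct)
  case (insert i I)
  then show ?case
    using k_smooth_on_add[OF assms(1), of k "f i" "\<lambda>x. \<Sum>i\<in>I. f i x"] by simp
qed (simp_all add: k_smooth_on_const)

lemma k_smooth_on_mult:
  fixes f h :: "_ \<Rightarrow> real"
  assumes "open S" and "k_smooth_on k S f" and "k_smooth_on k S h"
  shows "k_smooth_on k S (\<lambda>x. f x * h x)"
  using assms(2,3)
proof (induction k arbitrary: f h)
  case 0
  then show ?case by (simp add: continuous_on_mult)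
next
  case (Suc k)
  note D = k_smooth_on_SucD[OF Suc.prems(1)] k_smooth_on_SucD[OF Suc.prems(2)]
  show ?case
    by (rule k_smooth_on_SucI[OF assms(1) has_derivative_mult[OF D(1) D(3)]])
      (assumption, assumption,
        intro k_smooth_on_add[OF assms(1)] Suc.IH D(2,4) Suc.prems[THEN k_smooth_on_Suc_imp])
qed

lemma k_smooth_on_bounded_linear:
  assumes "bounded_linear L" and "open S" and "k_smooth_on k S f"
  shows "k_smooth_on k S (\<lambda>x. L (f x))"
  using assms(3)
proof (induction k arbitrary: f)
  case 0
  then show ?case by (simp add: bounded_linear.continuous_on[OF assms(1)])
next
  case (Suc k)
  note D = k_smooth_on_SucD[OF Suc.prems]
  show ?case
    by (rule k_smooth_on_SucI[OF assms(2) bounded_linear.has_derivative[OF assms(1) D(1)]])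
      (assumption, rule Suc.IH[OF D(2)])
qed

text \<open>The derivative along \<open>v\<close> is the derivative of \<open>f\<close> along the
  fixed direction \<open>(0, v)\<close>, so the induction stays within functions of this form. It
  serves to pass from the multiplication to a single left translation.\<close>

lemma k_smooth_on_Pair:
  assumes "open T" and "\<And>w. w \<in> T \<Longrightarrow> (a, w) \<in> S" and "k_smooth_on k S f"
  shows "k_smooth_on k T (\<lambda>w. f (a, w))"
  using assms(3)
proof (induction k arbitrary: f)
  case 0
  then show ?case
    by (auto intro!: continuous_on_compose2[where f = "Pair a" and g = f and t = S]
        continuous_on_Pair continuous_on_const continuous_on_id assms(2))
next
  case (Suc k)
  note D = k_smooth_on_SucD[OF Suc.prems]
  have "((\<lambda>w. f (a, w)) has_derivative (\<lambda>v. frechet_derivative f (at (a, x)) (0, v))) (at x)"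
    if "x \<in> T" for x
    by (rule has_derivative_compose[OF has_derivative_Pair[OF has_derivative_const has_derivative_ident]
          D(1)[OF assms(2)[OF that]]])
  then show ?case
    by (rule k_smooth_on_SucI[OF assms(1)]) (assumption, rule Suc.IH[OF D(2)])
qed

text \<open>Iterating directional derivatives of a composition requires expanding the chain rule in the
  coordinates of the intermediate space; this is where its finite dimension enters.\<close>

lemma k_smooth_on_compose:
  fixes f :: "'v::real_normed_vector \<Rightarrow> real" and B :: "'v set"
  assumes B: "finite B" "independent B" "span B = UNIV"
    and "open S" and "\<And>x. x \<in> S \<Longrightarrow> F x \<in> T"
    and "k_smooth_on k T f" and "k_smooth_on k S F"
  shows "k_smooth_on k S (\<lambda>x. f (F x))"
  using assms(6,7)
proof (induction k arbitrary: f)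
  case 0
  then show ?case
    using assms(5) by (auto intro: continuous_on_compose2[where g = f and t = T])
next
  case (Suc k)
  note D = k_smooth_on_SucD[OF Suc.prems(1)] k_smooth_on_SucD[OF Suc.prems(2)]
  let ?df = "\<lambda>x. frechet_derivative f (at (F x))" and ?dF = "\<lambda>x. frechet_derivative F (at x)"
  show ?case
  proof (rule k_smooth_on_SucI[OF assms(4)])
    show "((\<lambda>x. f (F x)) has_derivative (\<lambda>v. ?df x (?dF x v))) (at x)" if "x \<in> S" for x
      using has_derivative_compose[OF D(3)[OF that] D(1)[OF assms(5)[OF that]]] .
  next
    fix v
    \<comment> \<open>The direction \<open>?dF x v\<close> moves with \<open>x\<close>, whereas the
      induction hypothesis handles derivatives of \<open>f\<close> along fixed directions only. The
      basis vectors \<open>b\<close> are fixed, and the coefficients are smooth.\<close>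
    have expand: "(\<Sum>b\<in>B. representation B (?dF x v) b * ?df x b) = ?df x (?dF x v)"
      if "x \<in> S" for x
    proof -
      have lin: "linear (?df x)"
        using D(1)[OF assms(5)[OF that]] by (rule has_derivative_linear)
      have "?df x (?dF x v) = ?df x (\<Sum>b\<in>B. representation B (?dF x v) b *\<^sub>R b)"
        using B by (simp add: real_vector.sum_representation_eq)
      then show ?thesis by (simp add: linear_sum[OF lin] linear_scale[OF lin])
    qed
    have sm: "k_smooth_on k S (\<lambda>x. \<Sum>b\<in>B. representation B (?dF x v) b * ?df x b)"
      using k_smooth_on_Suc_imp[OF Suc.prems(2)]
      by (intro k_smooth_on_sum k_smooth_on_mult assms(4) D(4) Suc.IH[OF D(2)]
          k_smooth_on_bounded_linear[OF bounded_linear_representation[OF B]])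
    show "k_smooth_on k S (\<lambda>x. ?df x (?dF x v))"
      by (rule k_smooth_on_cong[OF assms(4) expand sm])
  qed
qed


subsection \<open>Traces on inner product spaces\<close>

lemma some_basis:
  assumes "subspace V"
  shows "independent (some_basis V)" and "span (some_basis V) = V"
proof -
  obtain B where "B \<subseteq> V" "independent B" "V \<subseteq> span B"
    using real_vector.maximal_independent_subset by blast
  then have "independent B \<and> span B = V"
    using assms by (simp add: real_vector.span_subspace)
  then have "independent (some_basis V) \<and> span (some_basis V) = V"
    unfolding some_basis_def by (rule someI)
  then show "independent (some_basis V)" and "span (some_basis V) = V"
    by auto
qed

text \<open>A sum over an infinite set is 0 by convention. Later case splits on the finiteness of
  \<open>some_basis V\<close> rest on this default.\<close>

lemma trace_on_infinite: "infinite (some_basis V) \<Longrightarrow> trace_on V T = 0"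
  by (simp add: trace_on_def)

lemma trace_on_cong:
  assumes "subspace V" and "\<And>x. x \<in> V \<Longrightarrow> T x = S x"
  shows "trace_on V T = trace_on V S"
  unfolding trace_on_def
  by (intro sum.cong refl) (metis assms real_vector.span_base some_basis(2))

lemma trace_on_add:
  assumes "subspace V" and "\<And>x. x \<in> V \<Longrightarrow> T x \<in> V" and "\<And>x. x \<in> V \<Longrightarrow> S x \<in> V"
  shows "trace_on V (\<lambda>x. T x + S x) = trace_on V T + trace_on V S"
proof -
  note B = some_basis[OF assms(1)]
  have "b \<in> V" if "b \<in> some_basis V" for b
    using that B(2) real_vector.span_base by blast
  then show ?thesis
    using assms B unfolding trace_on_def
    by (simp add: real_vector.representation_add sum.distrib)
qed

lemma trace_on_scaleR:
  assumes "subspace V" and "\<And>x. x \<in> V \<Longrightarrow> T x \<in> V"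
  shows "trace_on V (\<lambda>x. c *\<^sub>R T x) = c * trace_on V T"
proof -
  note B = some_basis[OF assms(1)]
  have "b \<in> V" if "b \<in> some_basis V" for b
    using that B(2) real_vector.span_base by blast
  then show ?thesis
    using assms B unfolding trace_on_def
    by (simp add: real_vector.representation_scale sum_distrib_left)
qed

locale inner_product_subspace =
  fixes V :: "'b::real_vector set" and ip :: "'b \<Rightarrow> 'b \<Rightarrow> real"
  assumes subspace: "subspace V" and inner_product: "inner_product_on V ip"
begin

lemma V_closed [simp, intro]:
  "0 \<in> V" "x \<in> V \<Longrightarrow> y \<in> V \<Longrightarrow> x + y \<in> V" "x \<in> V \<Longrightarrow> y \<in> V \<Longrightarrow> x - y \<in> V"
  "x \<in> V \<Longrightarrow> c *\<^sub>R x \<in> V" "x \<in> V \<Longrightarrow> - x \<in> V"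
  using subspace
  by (auto simp: real_vector.subspace_0 real_vector.subspace_add real_vector.subspace_diff
      real_vector.subspace_scale real_vector.subspace_neg)

lemma ip_commute: "x \<in> V \<Longrightarrow> y \<in> V \<Longrightarrow> ip x y = ip y x"
  using inner_product by (simp add: inner_product_on_def)

lemma ip_add_left: "x \<in> V \<Longrightarrow> y \<in> V \<Longrightarrow> z \<in> V \<Longrightarrow> ip (x + y) z = ip x z + ip y z"
  and ip_scale_left: "x \<in> V \<Longrightarrow> z \<in> V \<Longrightarrow> ip (c *\<^sub>R x) z = c * ip x z"
  using inner_product by (auto simp: inner_product_on_def linear_on_def)

lemma ip_diff_left:
  assumes "x \<in> V" and "y \<in> V" and "z \<in> V"
  shows "ip (x - y) z = ip x z - ip y z"
  using ip_add_left[of "x - y" y z] assms by simp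

lemma ip_add_right: "x \<in> V \<Longrightarrow> y \<in> V \<Longrightarrow> z \<in> V \<Longrightarrow> ip z (x + y) = ip z x + ip z y"
  and ip_scale_right: "x \<in> V \<Longrightarrow> z \<in> V \<Longrightarrow> ip z (c *\<^sub>R x) = c * ip z x"
  and ip_diff_right: "x \<in> V \<Longrightarrow> y \<in> V \<Longrightarrow> z \<in> V \<Longrightarrow> ip z (x - y) = ip z x - ip z y"
  by (simp_all add: ip_commute[of z] ip_add_left ip_scale_left ip_diff_left)

lemma ip_zero_left: "z \<in> V \<Longrightarrow> ip 0 z = 0"
  using ip_scale_left[of 0 z 0] by simp

lemma ip_sum_right:
  assumes "z \<in> V" and "\<And>i. i \<in> I \<Longrightarrow> f i \<in> V"
  shows "ip z (\<Sum>i\<in>I. f i) = (\<Sum>i\<in>I. ip z (f i))"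
  using assms
proof (induction I rule: infinite_finite_induct)
  case (insert i I)
  moreover have "(\<Sum>i\<in>I. f i) \<in> V"
    using insert.prems subspace by (intro real_vector.subspace_sum) auto
  ultimately show ?case
    by (simp add: ip_add_right)
qed (simp_all add: ip_commute[of z 0] ip_zero_left)

lemma ip_eqI:
  assumes "x \<in> V" and "y \<in> V" and "\<And>z. z \<in> V \<Longrightarrow> ip x z = ip y z"
  shows "x = y"
proof (rule ccontr)
  assume "x \<noteq> y"
  then have "ip (x - y) (x - y) > 0"
    using inner_product assms(1,2) by (simp add: inner_product_on_def)
  then show False
    using assms by (simp add: ip_diff_left)
qed

text \<open>A Gram-Schmidt step inside the induction. The induction hypothesis is used for two
  functionals: for \<open>ip x\<close>, which yields the orthogonal projection \<open>p\<close> of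
  the new vector, and for \<open>l\<close>. The solution \<open>z\<close> on \<open>B\<close> is
  then corrected along \<open>e = x - p\<close>, which leaves its values on \<open>B\<close>
  unchanged.\<close>

lemma riesz_finite_independent:
  assumes "finite B" and "independent B" and "B \<subseteq> V"
  shows "\<exists>z\<in>span B. \<forall>x\<in>B. ip z x = l x"
  using assms
proof (induction B arbitrary: l)
  case empty
  then show ?case by auto
next
  case (insert x B)
  then have x: "x \<notin> span B" "x \<in> V" and B: "independent B" "B \<subseteq> V"
    by (auto simp: independent_insert)
  have span_V: "span B \<subseteq> V"
    using B(2) subspace real_vector.span_minimal by blast
  obtain p where p: "p \<in> span B" "\<forall>y\<in>B. ip p y = ip x y"
    using insert.IH[OF B] by blast
  obtain z where z: "z \<in> span B" "\<forall>y\<in>B. ip z y = l y"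
    using insert.IH[OF B] by blast
  define e where "e = x - p"
  have V: "p \<in> V" "z \<in> V" "e \<in> V"
    using span_V p(1) z(1) x(2) by (auto simp: e_def)
  have e_orth: "ip e y = 0" if "y \<in> span B" for y
  proof -
    have "span B \<subseteq> {y \<in> V. ip e y = 0}"
    proof (rule real_vector.span_minimal)
      show "B \<subseteq> {y \<in> V. ip e y = 0}"
        using p(2) B(2) V x(2) by (auto simp: e_def ip_diff_left)
      show "subspace {y \<in> V. ip e y = 0}"
        using V(3) by (intro real_vector.subspaceI)
          (auto simp: ip_add_right ip_scale_right ip_commute[of e 0] ip_zero_left)
    qed
    then show ?thesis using that by blast
  qed
  have "e \<noteq> 0"
    using p(1) x(1) by (auto simp: e_def)
  then have "ip e e > 0"
    using inner_product V(3) by (simp add: inner_product_on_def)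
  \<comment> \<open>Since \<open>e\<close> is orthogonal to \<open>p\<close>, this number equals
    \<open>ip e e\<close>.\<close>
  then have e: "ip e x \<noteq> 0"
    using e_orth[OF p(1)] V x(2) ip_diff_right[of x p e] by (simp add: e_def)
  define w where "w = z + ((l x - ip z x) / ip e x) *\<^sub>R e"
  have w: "ip w y = ip z y + (l x - ip z x) / ip e x * ip e y" if "y \<in> V" for y
    using V that by (simp add: w_def ip_add_left ip_scale_left)
  have "w \<in> span (insert x B)"
    using z(1) p(1) unfolding w_def e_def
    by (intro real_vector.span_add real_vector.span_scale real_vector.span_diff)
      (auto intro: real_vector.span_base real_vector.span_mono[THEN subsetD, of B])
  moreover have "ip w x = l x"
    using w[OF x(2)] e by simp
  moreover have "ip w y = l y" if "y \<in> B" for y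
    using w[of y] that B(2) z(2) e_orth[OF real_vector.span_base[OF that]] by auto
  ultimately show ?case by blast
qed

text \<open>The vectors on which \<open>ip z\<close> and \<open>l\<close> agree form a subspace, so
  agreement on a basis suffices.\<close>

lemma riesz:
  assumes "finite (some_basis V)" and "linear_on V l"
  shows "\<exists>z\<in>V. \<forall>x\<in>V. ip z x = l x"
proof -
  let ?B = "some_basis V"
  note B = some_basis[OF subspace]
  have BV: "?B \<subseteq> V"
    using B(2) real_vector.span_superset by blast
  obtain z where z: "z \<in> V" "\<forall>x\<in>?B. ip z x = l x"
    using riesz_finite_independent[OF assms(1) B(1) BV] B(2) by blast
  have "l 0 = 0"
    using assms(2) V_closed(1) unfolding linear_on_def by (metis scaleR_zero_left)
  then have "subspace {x \<in> V. ip z x = l x}"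
    using z(1) assms(2)
    by (intro real_vector.subspaceI)
      (auto simp: linear_on_def ip_add_right ip_scale_right ip_commute[of z 0] ip_zero_left)
  then have "span ?B \<subseteq> {x \<in> V. ip z x = l x}"
    using z(2) BV by (intro real_vector.span_minimal) auto
  then show ?thesis
    using z(1) B(2) by blast
qed

text \<open>With the dual basis \<open>d\<close> of a basis \<open>B\<close>, the trace is \<open>\<Sum>b\<in>B. ip (d b) (T b)\<close>. Expanding \<open>d b\<close>
  in \<open>B\<close> has the symmetric coefficients \<open>ip (d b) (d c)\<close>, so that adjoints have equal traces.\<close>

lemma trace_on_adjoint:
  assumes "\<And>x. x \<in> V \<Longrightarrow> T x \<in> V" and "\<And>x. x \<in> V \<Longrightarrow> S x \<in> V"
    and adj: "\<And>x y. x \<in> V \<Longrightarrow> y \<in> V \<Longrightarrow> ip (T x) y = ip x (S y)"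
  shows "trace_on V T = trace_on V S"
proof (cases "finite (some_basis V)")
  case False
  then show ?thesis by (simp add: trace_on_infinite)
next
  case fin: True
  let ?B = "some_basis V"
  note B = some_basis[OF subspace]
  have BV: "\<And>b. b \<in> ?B \<Longrightarrow> b \<in> V"
    using B(2) real_vector.span_base by blast
  have "\<forall>b\<in>?B. \<exists>z\<in>V. \<forall>x\<in>?B. ip z x = (if x = b then 1 else 0)"
  proof
    fix b
    show "\<exists>z\<in>V. \<forall>x\<in>?B. ip z x = (if x = b then 1 else 0)"
      using riesz_finite_independent[OF fin B(1), of "\<lambda>x. if x = b then 1 else 0"] BV B(2) by blast
  qed
  then obtain d where dV: "\<And>b. b \<in> ?B \<Longrightarrow> d b \<in> V"
    and d: "\<And>b x. b \<in> ?B \<Longrightarrow> x \<in> ?B \<Longrightarrow> ip (d b) x = (if x = b then 1 else 0)"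
    by metis
  have expand: "v = (\<Sum>c\<in>?B. representation ?B v c *\<^sub>R c)" if "v \<in> V" for v
    using that B fin by (simp add: real_vector.sum_representation_eq)
  have rep: "representation ?B v b = ip (d b) v" if "v \<in> V" "b \<in> ?B" for v b
  proof -
    have "ip (d b) v = (\<Sum>c\<in>?B. ip (d b) (representation ?B v c *\<^sub>R c))"
      by (subst expand[OF that(1)], rule ip_sum_right) (use that dV BV in auto)
    also have "\<dots> = (\<Sum>c\<in>?B. representation ?B v c * (if c = b then 1 else 0))"
      using that dV BV d by (intro sum.cong) (auto simp: ip_scale_right)
    also have "\<dots> = representation ?B v b"
      using fin that(2) by (simp add: if_distrib[of "(*) _"] cong: if_cong)
    finally show ?thesis by simp
  qed
  have trace: "trace_on V F = (\<Sum>b\<in>?B. \<Sum>c\<in>?B. ip (d b) (d c) * ip (F b) c)"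
    if F: "\<And>x. x \<in> V \<Longrightarrow> F x \<in> V" for F
    unfolding trace_on_def
  proof (rule sum.cong[OF refl])
    fix b assume b: "b \<in> ?B"
    have "representation ?B (F b) b = ip (F b) (d b)"
      using rep[OF F[OF BV[OF b]] b] b F BV dV by (simp add: ip_commute)
    also have "\<dots> = (\<Sum>c\<in>?B. ip (F b) (representation ?B (d b) c *\<^sub>R c))"
      by (subst expand[OF dV[OF b]], rule ip_sum_right) (use b F BV in auto)
    also have "\<dots> = (\<Sum>c\<in>?B. ip (d b) (d c) * ip (F b) c)"
    proof (rule sum.cong[OF refl])
      fix c assume c: "c \<in> ?B"
      have "representation ?B (d b) c = ip (d b) (d c)"
        using rep[OF dV[OF b] c] ip_commute dV b c by simp
      then show "ip (F b) (representation ?B (d b) c *\<^sub>R c) = ip (d b) (d c) * ip (F b) c"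
        using F BV b c by (simp add: ip_scale_right)
    qed
    finally show "representation ?B (F b) b = (\<Sum>c\<in>?B. ip (d b) (d c) * ip (F b) c)" .
  qed
  have "trace_on V T = (\<Sum>b\<in>?B. \<Sum>c\<in>?B. ip (d b) (d c) * ip (T b) c)"
    using assms(1) by (rule trace)
  also have "\<dots> = (\<Sum>c\<in>?B. \<Sum>b\<in>?B. ip (d b) (d c) * ip (T b) c)"
    by (rule sum.swap)
  also have "\<dots> = (\<Sum>c\<in>?B. \<Sum>b\<in>?B. ip (d c) (d b) * ip (S c) b)"
  proof (intro sum.cong refl)
    fix c b assume cb: "c \<in> ?B" "b \<in> ?B"
    have "ip (T b) c = ip (S c) b"
      using adj[of b c] ip_commute[of b "S c"] assms(2) cb BV by simp
    then show "ip (d b) (d c) * ip (T b) c = ip (d c) (d b) * ip (S c) b"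
      using ip_commute dV cb by simp
  qed
  also have "\<dots> = trace_on V S"
    by (rule trace[symmetric]) (rule assms(2))
  finally show ?thesis .
qed

end


subsection \<open>Ricci curvature of a metric Lie algebra\<close>

text \<open>The Lie bracket does not occur as a parameter: it is recovered from the Levi-Civita product \<open>n\<close>
  by vanishing torsion.\<close>

locale levi_civita_product = inner_product_subspace V ip
  for V :: "'b::real_vector set" and ip +
  fixes n :: "'b \<Rightarrow> 'b \<Rightarrow> 'b"
  assumes n_closed [simp, intro]: "x \<in> V \<Longrightarrow> y \<in> V \<Longrightarrow> n x y \<in> V"
    and n_add_left: "x \<in> V \<Longrightarrow> y \<in> V \<Longrightarrow> z \<in> V \<Longrightarrow> n (x + y) z = n x z + n y z"
    and n_add_right: "x \<in> V \<Longrightarrow> y \<in> V \<Longrightarrow> z \<in> V \<Longrightarrow> n x (y + z) = n x y + n x z"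
    and n_scale_right: "x \<in> V \<Longrightarrow> y \<in> V \<Longrightarrow> n x (c *\<^sub>R y) = c *\<^sub>R n x y"
    and n_metric: "x \<in> V \<Longrightarrow> y \<in> V \<Longrightarrow> z \<in> V \<Longrightarrow> ip (n x y) z = - ip y (n x z)"
    and jacobi: "x \<in> V \<Longrightarrow> y \<in> V \<Longrightarrow> z \<in> V \<Longrightarrow>
      (n x (n y z - n z y) - n (n y z - n z y) x) +
      (n y (n z x - n x z) - n (n z x - n x z) y) +
      (n z (n x y - n y x) - n (n x y - n y x) z) = 0"
begin

definition curv :: "'b \<Rightarrow> 'b \<Rightarrow> 'b \<Rightarrow> 'b" where
  "curv x y z = n x (n y z) - n y (n x z) - n (n x y - n y x) z"

definition ric :: "'b \<Rightarrow> 'b \<Rightarrow> real" where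
  "ric x y = trace_on V (\<lambda>z. curv z x y)"

lemma curv_closed [simp, intro]: "x \<in> V \<Longrightarrow> y \<in> V \<Longrightarrow> z \<in> V \<Longrightarrow> curv x y z \<in> V"
  by (simp add: curv_def)

lemma n_diff_left: "x \<in> V \<Longrightarrow> y \<in> V \<Longrightarrow> z \<in> V \<Longrightarrow> n (x - y) z = n x z - n y z"
  using n_add_left[of "x - y" y z] by simp

lemma n_diff_right: "x \<in> V \<Longrightarrow> y \<in> V \<Longrightarrow> z \<in> V \<Longrightarrow> n x (y - z) = n x y - n x z"
  using n_add_right[of x "y - z" z] by simp

lemma curv_add_right:
  "x \<in> V \<Longrightarrow> y \<in> V \<Longrightarrow> z \<in> V \<Longrightarrow> w \<in> V \<Longrightarrow> curv x y (z + w) = curv x y z + curv x y w"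
  by (simp add: curv_def n_add_right)

lemma curv_scale_right:
  "x \<in> V \<Longrightarrow> y \<in> V \<Longrightarrow> z \<in> V \<Longrightarrow> curv x y (c *\<^sub>R z) = c *\<^sub>R curv x y z"
  by (simp add: curv_def n_scale_right scaleR_diff_right)

lemma ip_curv_skew12:
  assumes "x \<in> V" "y \<in> V" "z \<in> V" "w \<in> V"
  shows "ip (curv x y z) w = - ip (curv y x z) w"
  using assms by (simp add: curv_def ip_diff_left n_diff_left)

text \<open>By \<open>n_metric\<close> every operator \<open>n x\<close> is skew-adjoint, and
  commutators and differences of skew-adjoint operators are skew-adjoint again.\<close>

lemma ip_curv_skew34:
  assumes "x \<in> V" "y \<in> V" "z \<in> V" "w \<in> V"
  shows "ip (curv x y z) w = - ip (curv x y w) z"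
proof -
  have "ip (curv x y z) w = - ip z (curv x y w)"
    using assms by (simp add: curv_def ip_diff_left ip_diff_right n_metric)
  then show ?thesis
    using assms by (simp add: ip_commute)
qed

text \<open>Since the bracket is written as \<open>n x y - n y x\<close>, the cyclic sum expands to
  the terms of \<open>jacobi\<close> in another order.\<close>

lemma bianchi:
  assumes "x \<in> V" "y \<in> V" "z \<in> V"
  shows "curv x y z + curv y z x + curv z x y = 0"
  using jacobi[OF assms] assms by (simp add: curv_def n_diff_right n_diff_left algebra_simps)

lemma ip_bianchi:
  assumes "x \<in> V" "y \<in> V" "z \<in> V" "w \<in> V"
  shows "ip (curv x y z) w + ip (curv y z x) w + ip (curv z x y) w = 0"
proof -
  have "ip (curv x y z + curv y z x + curv z x y) w = 0"
    using assms by (simp add: bianchi ip_zero_left)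
  then show ?thesis
    using assms by (simp add: ip_add_left)
qed

text \<open>The classical argument: add the first Bianchi identities for the four cyclic rotations
  of \<open>x\<close>, \<open>y\<close>, \<open>z\<close>, \<open>w\<close>. Of the twelve terms,
  eight cancel in pairs by skewness in the last two arguments.\<close>

lemma ip_curv_pair_sym:
  assumes "x \<in> V" "y \<in> V" "z \<in> V" "w \<in> V"
  shows "ip (curv z x y) w = ip (curv y w z) x"
proof -
  note bianchi4 = ip_bianchi[OF assms] ip_bianchi[OF assms(2,3,4,1)]
    ip_bianchi[OF assms(3,4,1,2)] ip_bianchi[OF assms(4,1,2,3)]
  have "ip (curv x y w) z = - ip (curv x y z) w" "ip (curv y z w) x = - ip (curv y z x) w"
    "ip (curv z w x) y = - ip (curv z w y) x" "ip (curv w x y) z = - ip (curv w x z) y"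
    by (rule ip_curv_skew34; fact assms)+
  \<comment> \<open>The four surviving terms coincide in pairs, so each side of the claim occurs
    twice, with opposite signs.\<close>
  moreover have "ip (curv x z w) y = ip (curv z x y) w" "ip (curv y w x) z = ip (curv w y z) x"
    "ip (curv w y z) x = - ip (curv y w z) x"
    using ip_curv_skew12[of x z w y] ip_curv_skew34[of z x w y] ip_curv_skew12[of y w x z]
      ip_curv_skew34[of w y x z] ip_curv_skew12[of w y z x] assms by simp_all
  ultimately show ?thesis
    using bianchi4 by linarith
qed

lemma ric_commute:
  assumes "x \<in> V" "y \<in> V"
  shows "ric x y = ric y x"
  unfolding ric_def
proof (rule trace_on_adjoint)
  fix z w assume "z \<in> V" "w \<in> V"
  \<comment> \<open>Pair symmetry gives \<open>ip (curv y w z) x\<close>; swapping the first two and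
    then the last two arguments changes the sign twice.\<close>
  then show "ip (curv z x y) w = ip z (curv w y x)"
    using assms ip_curv_pair_sym[of x y z w] ip_curv_skew12[of y w z x]
      ip_curv_skew34[of w y z x] ip_commute[of z "curv w y x"] by simp
qed (use assms in auto)

lemma linear_on_ric:
  assumes "x \<in> V"
  shows "linear_on V (ric x)"
  unfolding linear_on_def
proof (intro conjI ballI allI)
  fix y z assume "y \<in> V" "z \<in> V"
  then show "ric x (y + z) = ric x y + ric x z"
    using assms subspace trace_on_cong[of V "\<lambda>w. curv w x (y + z)" "\<lambda>w. curv w x y + curv w x z"]
    by (simp add: ric_def curv_add_right trace_on_add)
next
  fix c y assume "y \<in> V"
  then show "ric x (c *\<^sub>R y) = c *\<^sub>R ric x y"
    using assms subspace trace_on_cong[of V "\<lambda>w. curv w x (c *\<^sub>R y)" "\<lambda>w. c *\<^sub>R curv w x y"]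
    by (simp add: ric_def curv_scale_right trace_on_scaleR)
qed

text \<open>Unique existence is what the definite description in \<open>ricci_operator\<close>
  requires.\<close>

lemma ric_representable:
  assumes "x \<in> V"
  shows "\<exists>!z. z \<in> V \<and> (\<forall>y\<in>V. ric x y = ip z y)"
proof -
  have "\<exists>z\<in>V. \<forall>y\<in>V. ip z y = ric x y"
  proof (cases "finite (some_basis V)")
    case True
    then show ?thesis
      using riesz linear_on_ric assms by blast
  next
    \<comment> \<open>Here all traces are 0, so \<open>ric x\<close> is the zero functional,
      represented by 0.\<close>
    case False
    then show ?thesis
      by (intro bexI[of _ 0]) (auto simp: ric_def trace_on_infinite ip_zero_left)
  qed
  then show ?thesis
    using ip_eqI by metis
qed

end


subsection \<open>Smooth functions\<close>

lemma smooth_onD: "smooth_on S f \<Longrightarrow> k_smooth_on k S f"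
  by (simp add: smooth_on_def)

context lie_group
begin

abbreviation "SF \<equiv> smooth_functions A"
abbreviation "VF \<equiv> vector_fields A"
abbreviation "LA \<equiv> lie_algebra mul A"

lemma chart:
  assumes "(U, \<phi>) \<in> A"
  shows "open U" and "open (\<phi> ` U)" and "continuous_on (\<phi> ` U) (inv_into U \<phi>)"
    and "inj_on \<phi> U"
proof -
  have *: "open U \<and> open (\<phi> ` U) \<and> homeomorphism U (\<phi> ` U) \<phi> (inv_into U \<phi>)"
    using smooth_atlas assms unfolding smooth_atlas_def by blast
  then show "open U" and "open (\<phi> ` U)" and "continuous_on (\<phi> ` U) (inv_into U \<phi>)"
    by (auto simp: homeomorphism_def)
  show "inj_on \<phi> U"
    using * by (auto simp: homeomorphism_def intro: inj_on_inverseI)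
qed

lemma chart_exists: "\<exists>U \<phi>. (U, \<phi>) \<in> A \<and> p \<in> U"
  using smooth_atlas unfolding smooth_atlas_def by blast

lemma smooth_functionsI:
  assumes "\<And>U \<phi> k. (U, \<phi>) \<in> A \<Longrightarrow> k_smooth_on k (\<phi> ` U) (\<lambda>x. f (inv_into U \<phi> x))"
  shows "f \<in> SF"
  using assms by (auto simp: smooth_functions_def smooth_on_def o_def)

lemma smooth_functionsD:
  assumes "f \<in> SF" and "(U, \<phi>) \<in> A"
  shows "k_smooth_on k (\<phi> ` U) (\<lambda>x. f (inv_into U \<phi> x))"
  using assms by (auto simp: smooth_functions_def smooth_on_def o_def)

lemma smooth_functions_const [simp, intro]: "(\<lambda>p. c) \<in> SF"
  by (intro smooth_functionsI k_smooth_on_const)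

lemma smooth_functions_add [simp, intro]:
  assumes "f \<in> SF" and "h \<in> SF"
  shows "(\<lambda>p. f p + h p) \<in> SF"
  by (intro smooth_functionsI k_smooth_on_add[OF chart(2)] smooth_functionsD[OF assms(1)]
      smooth_functionsD[OF assms(2)])

lemma smooth_functions_mult [simp, intro]:
  assumes "f \<in> SF" and "h \<in> SF"
  shows "(\<lambda>p. f p * h p) \<in> SF"
  by (intro smooth_functionsI k_smooth_on_mult[OF chart(2)] smooth_functionsD[OF assms(1)]
      smooth_functionsD[OF assms(2)])

lemma smooth_functions_diff [simp, intro]:
  assumes "f \<in> SF" and "h \<in> SF"
  shows "(\<lambda>p. f p - h p) \<in> SF"
  using smooth_functions_add[OF assms(1) smooth_functions_mult[OF smooth_functions_const assms(2)],
      of "-1"]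
  by simp

text \<open>In charts the translated function is the chart expression of \<open>f\<close> composed
  with \<open>m (\<phi>0 a, w)\<close>, where \<open>m\<close> is the chart expression of the
  multiplication. A target chart \<open>V\<close> around \<open>mul a q\<close> covers only a
  neighbourhood of the point considered, so the claim is proved locally, on
  \<open>T\<close>.\<close>

lemma smooth_functions_translate:
  assumes f: "f \<in> SF"
  shows "(\<lambda>p. f (mul a p)) \<in> SF"
proof (rule smooth_functionsI, rule k_smooth_on_local)
  fix U \<phi> k x
  assume U: "(U, \<phi>) \<in> A" and "x \<in> \<phi> ` U"
  then obtain q where q: "q \<in> U" "x = \<phi> q"
    by blast
  obtain U0 \<phi>0 where U0: "(U0, \<phi>0) \<in> A" "a \<in> U0"
    using chart_exists by blast
  obtain V \<psi> where V: "(V, \<psi>) \<in> A" "mul a q \<in> V"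
    using chart_exists by blast
  obtain B0 :: "'v set" where B0: "finite B0" "span B0 = UNIV"
    using finite_dimensional_model by blast
  \<comment> \<open>The composition lemma expands in a basis; the model space comes with a finite
    spanning set.\<close>
  obtain B where B: "B \<subseteq> B0" "independent B" "span B = span B0"
    using real_vector.maximal_independent_subset[of B0]
    by (metis real_vector.span_eq real_vector.span_superset subset_trans)
  have fin: "finite B" "span B = UNIV"
    using B B0 by (auto intro: finite_subset)
  define T where "T = \<phi> ` U \<inter> (\<lambda>w. mul a (inv_into U \<phi> w)) -` V"
  have cont: "continuous_on UNIV (\<lambda>(p, q). mul p q)"
    using smooth_mult by (simp add: smooth_map_def)
  have "continuous_on (\<phi> ` U) (\<lambda>w. (\<lambda>(p, q). mul p q) (a, inv_into U \<phi> w))"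
    by (rule continuous_on_compose2[OF cont])
      (auto intro!: continuous_on_Pair continuous_on_const chart(3)[OF U])
  then have T: "open T"
    unfolding T_def using chart(1)[OF V(1)] chart(2)[OF U]
    by (auto intro: continuous_open_preimage)
  define W where "W = map_prod \<phi>0 \<phi> ` ((U0 \<times> U) \<inter> (\<lambda>(p, q). mul p q) -` V)"
  define m where "m = (\<psi> \<circ> (\<lambda>(p, q). mul p q) \<circ> inv_into (U0 \<times> U) (map_prod \<phi>0 \<phi>))"
  have "(U0 \<times> U, map_prod \<phi>0 \<phi>) \<in> prod_atlas A A"
    using U0(1) U by (auto simp: prod_atlas_def)
  then have "smooth_on W m"
    using smooth_mult V(1) unfolding smooth_map_def W_def m_def by fast
  then have smooth_m: "k_smooth_on k W m"
    by (rule smooth_onD)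
  have T_point: "\<exists>r\<in>U. w = \<phi> r \<and> mul a r \<in> V" if "w \<in> T" for w
    using that chart(4)[OF U] by (auto simp: T_def)
  have T_W: "(\<phi>0 a, w) \<in> W" if w: "w \<in> T" for w
    using T_point[OF w] U0(2) unfolding W_def by force
  have m: "m (\<phi>0 a, w) = \<psi> (mul a (inv_into U \<phi> w))" if w: "w \<in> T" for w
  proof -
    obtain r where r: "r \<in> U" "w = \<phi> r"
      using T_point[OF w] by blast
    have "inj_on (map_prod \<phi>0 \<phi>) (U0 \<times> U)"
      using chart(4)[OF U] chart(4)[OF U0(1)] by (rule map_prod_inj_on[rotated])
    then have "inv_into (U0 \<times> U) (map_prod \<phi>0 \<phi>) (map_prod \<phi>0 \<phi> (a, r)) = (a, r)"
      using U0(2) r(1) by (intro inv_into_f_f) auto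
    then show ?thesis
      using r chart(4)[OF U] by (simp add: m_def)
  qed
  have "k_smooth_on k T (\<lambda>w. f (inv_into V \<psi> (m (\<phi>0 a, w))))"
  proof (rule k_smooth_on_compose[OF fin(1) B(2) fin(2) T])
    show "k_smooth_on k (\<psi> ` V) (\<lambda>y. f (inv_into V \<psi> y))"
      by (rule smooth_functionsD[OF f V(1)])
    show "m (\<phi>0 a, w) \<in> \<psi> ` V" if "w \<in> T" for w
      using that m by (simp add: T_def)
    show "k_smooth_on k T (\<lambda>w. m (\<phi>0 a, w))"
      by (rule k_smooth_on_Pair[OF T T_W smooth_m])
  qed
  moreover have "f (inv_into V \<psi> (m (\<phi>0 a, w))) = f (mul a (inv_into U \<phi> w))" if "w \<in> T" for w
    using that m chart(4)[OF V(1)] by (simp add: T_def)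
  ultimately have "k_smooth_on k T (\<lambda>w. f (mul a (inv_into U \<phi> w)))"
    by (rule k_smooth_on_cong[OF T, rotated])
  moreover have "x \<in> T"
    using q V(2) chart(4)[OF U] by (simp add: T_def)
  ultimately show "\<exists>T. open T \<and> x \<in> T \<and> k_smooth_on k T (\<lambda>w. f (mul a (inv_into U \<phi> w)))"
    using T by blast
qed


subsection \<open>Tangent vectors and left translations\<close>

lemma tangent_add:
  assumes "v \<in> tangent_space A p" and "f \<in> SF" and "h \<in> SF"
  shows "v (\<lambda>q. f q + h q) = v f + v h"
  using assms by (simp add: tangent_space_def linear_on_def plus_fun_def)

lemma tangent_scale:
  assumes "v \<in> tangent_space A p" and "f \<in> SF"
  shows "v (\<lambda>q. c * f q) = c * v f"
  using assms by (simp add: tangent_space_def linear_on_def scaleR_fun_def)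

lemma tangent_mult:
  assumes "v \<in> tangent_space A p" and "f \<in> SF" and "h \<in> SF"
  shows "v (\<lambda>q. f q * h q) = f p * v h + h p * v f"
  using assms by (simp add: tangent_space_def times_fun_def)

lemma tangent_diff:
  assumes "v \<in> tangent_space A p" and "f \<in> SF" and "h \<in> SF"
  shows "v (\<lambda>q. f q - h q) = v f - v h"
  using tangent_add[OF assms(1) smooth_functions_diff[OF assms(2,3)] assms(3)] by simp

lemma tangent_const:
  assumes "v \<in> tangent_space A p"
  shows "v (\<lambda>q. c) = 0"
  using tangent_scale[OF assms smooth_functions_const, of c 1]
    tangent_mult[OF assms smooth_functions_const smooth_functions_const, of 1 1] by simp

lemma tangent_not_smooth: "v \<in> tangent_space A p \<Longrightarrow> f \<notin> SF \<Longrightarrow> v f = 0"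
  by (simp add: tangent_space_def)

lemma tangentI:
  assumes "\<And>f h. f \<in> SF \<Longrightarrow> h \<in> SF \<Longrightarrow> v (\<lambda>q. f q + h q) = v f + v h"
    and "\<And>c f. f \<in> SF \<Longrightarrow> v (\<lambda>q. c * f q) = c * v f"
    and "\<And>f h. f \<in> SF \<Longrightarrow> h \<in> SF \<Longrightarrow> v (\<lambda>q. f q * h q) = f p * v h + h p * v f"
    and "\<And>f. f \<notin> SF \<Longrightarrow> v f = 0"
  shows "v \<in> tangent_space A p"
  using assms
  by (simp add: tangent_space_def linear_on_def plus_fun_def scaleR_fun_def times_fun_def)

lemma subspace_tangent_space: "subspace (tangent_space A p)"
proof (rule real_vector.subspaceI)
  show "0 \<in> tangent_space A p"
    by (rule tangentI) auto
next
  fix u v assume "u \<in> tangent_space A p" "v \<in> tangent_space A p"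
  then show "u + v \<in> tangent_space A p"
    by (intro tangentI)
      (simp_all add: tangent_add tangent_scale tangent_mult tangent_not_smooth algebra_simps)
next
  fix c v assume "v \<in> tangent_space A p"
  then show "c *\<^sub>R v \<in> tangent_space A p"
    by (intro tangentI)
      (simp_all add: scaleR_fun_def tangent_add tangent_scale tangent_mult tangent_not_smooth
        algebra_simps)
qed

lemma vector_fields_tangent: "X \<in> VF \<Longrightarrow> X p \<in> tangent_space A p"
  and vector_fields_smooth: "X \<in> VF \<Longrightarrow> f \<in> SF \<Longrightarrow> (\<lambda>p. X p f) \<in> SF"
  by (auto simp: vector_fields_def)

lemma subspace_vector_fields: "subspace VF"
proof (rule real_vector.subspaceI)
  show "0 \<in> VF"
    by (simp add: vector_fields_def real_vector.subspace_0[OF subspace_tangent_space])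
next
  fix X Y assume "X \<in> VF" "Y \<in> VF"
  then show "X + Y \<in> VF"
    by (simp add: vector_fields_def real_vector.subspace_add[OF subspace_tangent_space])
next
  fix c X assume "X \<in> VF"
  then show "c *\<^sub>R X \<in> VF"
    using real_vector.subspace_scale[OF subspace_tangent_space]
    by (simp add: vector_fields_def scaleR_fun_def)
qed

lemma mul_cancel [simp]: "mul (iv a) (mul a p) = p" "mul a (mul (iv a) p) = p"
  by (simp_all flip: assoc)

lemma differential_apply: "f \<in> SF \<Longrightarrow> differential A (mul a) v f = v (\<lambda>q. f (mul a q))"
  by (simp add: differential_def o_def)

lemma differential_tangent:
  assumes "v \<in> tangent_space A p"
  shows "differential A (mul a) v \<in> tangent_space A (mul a p)"
proof (rule tangentI)
  fix f assume "f \<notin> SF"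
  then show "differential A (mul a) v f = 0"
    by (simp add: differential_def)
qed (simp_all add: differential_apply smooth_functions_translate tangent_add[OF assms]
    tangent_scale[OF assms] tangent_mult[OF assms])

lemma differential_cancel:
  assumes "v \<in> tangent_space A p"
  shows "differential A (mul (iv a)) (differential A (mul a) v) = v"
    and "differential A (mul a) (differential A (mul (iv a)) v) = v"
proof -
  have "differential A (mul (iv a)) (differential A (mul a) v) f = v f \<and>
      differential A (mul a) (differential A (mul (iv a)) v) f = v f" for f
  proof (cases "f \<in> SF")
    \<comment> \<open>Both sides are 0, by the convention for functions that are not smooth.\<close>
    case False
    then show ?thesis
      using assms by (simp add: differential_def tangent_not_smooth)
  qed (simp add: differential_apply smooth_functions_translate)
  then show "differential A (mul (iv a)) (differential A (mul a) v) = v"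
    and "differential A (mul a) (differential A (mul (iv a)) v) = v"
    by auto
qed

text \<open>The pullback of a field along the left translation by \<open>a\<close>, which is the
  pushforward along the translation by \<open>iv a\<close>.\<close>

definition pull :: "'a \<Rightarrow> 'a vfield \<Rightarrow> 'a vfield" where
  "pull a X = (\<lambda>p. differential A (mul (iv a)) (X (mul a p)))"

lemma pull_apply: "f \<in> SF \<Longrightarrow> pull a X p f = X (mul a p) (\<lambda>q. f (mul (iv a) q))"
  by (simp add: pull_def differential_apply)

lemma pull_vector_fields [simp, intro]:
  assumes "X \<in> VF"
  shows "pull a X \<in> VF"
proof -
  have "pull a X p \<in> tangent_space A p" for p
    using differential_tangent[of "X (mul a p)" "mul a p" "iv a"] vector_fields_tangent[OF assms]
    by (simp add: pull_def)
  moreover have "(\<lambda>p. pull a X p f) \<in> SF" if "f \<in> SF" for f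
    unfolding pull_apply[OF that]
    using smooth_functions_translate[OF vector_fields_smooth[OF assms
          smooth_functions_translate[OF that]]] .
  ultimately show ?thesis
    by (simp add: vector_fields_def)
qed

text \<open>Shows that every vector field is a pullback, as the uniqueness argument for
  \<open>nabla\<close> demands.\<close>

lemma pull_pull_inverse:
  assumes "X \<in> VF"
  shows "pull a (pull (iv a) X) = X"
proof
  fix p
  have "pull a (pull (iv a) X) p = differential A (mul (iv a)) (differential A (mul (iv (iv a))) (X p))"
    by (simp add: pull_def)
  also have "\<dots> = X p"
    using differential_cancel(2)[of "X p" p "iv a"] vector_fields_tangent[OF assms] by simp
  finally show "pull a (pull (iv a) X) p = X p" .
qed

lemma lie_algebra_iff_pull: "X \<in> LA \<longleftrightarrow> X \<in> VF \<and> (\<forall>a. pull a X = X)"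
proof -
  have "(\<forall>p. X (mul a p) = differential A (mul a) (X p)) \<longleftrightarrow> pull a X = X" if "X \<in> VF" for a
  proof
    assume "\<forall>p. X (mul a p) = differential A (mul a) (X p)"
    then show "pull a X = X"
      using that differential_cancel(1)[OF vector_fields_tangent[OF that]] by (auto simp: pull_def)
  next
    assume "pull a X = X"
    then have "differential A (mul a) (X p) = X (mul a p)" for p
      using that differential_cancel(2)[OF vector_fields_tangent[OF that]]
      by (metis pull_def)
    then show "\<forall>p. X (mul a p) = differential A (mul a) (X p)"
      by simp
  qed
  then show ?thesis
    by (auto simp: lie_algebra_def)
qed

lemma lie_algebra_vector_field [simp]: "X \<in> LA \<Longrightarrow> X \<in> VF"
  and lie_algebra_pull: "X \<in> LA \<Longrightarrow> pull a X = X"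
  by (auto simp: lie_algebra_iff_pull)

lemma subspace_lie_algebra: "subspace LA"
proof (rule real_vector.subspaceI)
  show "0 \<in> LA"
    by (auto simp: lie_algebra_iff_pull real_vector.subspace_0[OF subspace_vector_fields] pull_def
        differential_def fun_eq_iff)
next
  fix X Y assume *: "X \<in> LA" "Y \<in> LA"
  have "pull a (X + Y) = pull a X + pull a Y" for a
    by (auto simp: pull_def differential_def fun_eq_iff)
  with * show "X + Y \<in> LA"
    by (simp add: lie_algebra_iff_pull real_vector.subspace_add[OF subspace_vector_fields])
next
  fix c X assume *: "X \<in> LA"
  have "pull a (c *\<^sub>R X) = c *\<^sub>R pull a X" for a
    by (auto simp: pull_def differential_def fun_eq_iff scaleR_fun_def)
  with * show "c *\<^sub>R X \<in> LA"
    by (simp add: lie_algebra_iff_pull real_vector.subspace_scale[OF subspace_vector_fields])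
qed

lemma lie_bracket_apply:
  "f \<in> SF \<Longrightarrow> lie_bracket A X Y p f = X p (\<lambda>q. Y q f) - Y p (\<lambda>q. X q f)"
  by (simp add: lie_bracket_def)

lemma pull_lie_bracket:
  assumes X: "X \<in> VF" and Y: "Y \<in> VF"
  shows "pull a (lie_bracket A X Y) = lie_bracket A (pull a X) (pull a Y)"
proof (intro ext)
  fix p f
  show "pull a (lie_bracket A X Y) p f = lie_bracket A (pull a X) (pull a Y) p f"
  proof (cases "f \<in> SF")
    case True
    \<comment> \<open>In an iterated derivative the inner translation by \<open>a\<close> cancels
      against the outer one by \<open>iv a\<close>.\<close>
    have "pull a Z p (\<lambda>q. pull a W q f) = Z (mul a p) (\<lambda>q. W q (\<lambda>r. f (mul (iv a) r)))"
      if "W \<in> VF" for Z W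
    proof -
      have "(\<lambda>q. pull a W q f) \<in> SF"
        by (rule vector_fields_smooth[OF pull_vector_fields[OF that] True])
      then show ?thesis
        using True by (simp add: pull_apply)
    qed
    then show ?thesis
      using True X Y by (simp add: pull_apply[of f a "lie_bracket A X Y"] lie_bracket_apply
          smooth_functions_translate)
  next
    case False
    then show ?thesis by (simp add: pull_def differential_def lie_bracket_def)
  qed
qed

lemma jacobi_identity:
  assumes "X \<in> VF" "Y \<in> VF" "Z \<in> VF"
  shows "lie_bracket A X (lie_bracket A Y Z) + lie_bracket A Y (lie_bracket A Z X) +
    lie_bracket A Z (lie_bracket A X Y) = 0"
proof (intro ext)
  fix p f
  show "(lie_bracket A X (lie_bracket A Y Z) + lie_bracket A Y (lie_bracket A Z X) +
    lie_bracket A Z (lie_bracket A X Y)) p f = 0 p f"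
  proof (cases "f \<in> SF")
    case True
    then show ?thesis
      using assms
      by (simp add: lie_bracket_apply assms[THEN vector_fields_smooth]
          assms[THEN vector_fields_tangent, THEN tangent_diff])
  next
    case False
    then show ?thesis by (simp add: lie_bracket_def)
  qed
qed

end


subsection \<open>The Levi-Civita connection on left-invariant vector fields\<close>

locale levi_civita_lie_group = lie_group mul one iv A
  for mul :: "'a::{t2_space, second_countable_topology} \<Rightarrow> 'a \<Rightarrow> 'a" and one iv
    and A :: "('a, 'v::real_normed_vector) atlas" +
  fixes g :: "'a metric_tensor" and nabla :: "'a connection"
  assumes riemannian: "riemannian_metric A g" and invariant: "left_invariant mul A g"
    and levi_civita: "levi_civita_connection A g nabla"
begin

lemma inner_product_tangent: "inner_product_subspace (tangent_space A p) (g p)"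
  using riemannian subspace_tangent_space
  by (simp add: inner_product_subspace_def riemannian_metric_def)

lemmas g_diff_left = inner_product_subspace.ip_diff_left[OF inner_product_tangent]
lemmas g_commute = inner_product_subspace.ip_commute[OF inner_product_tangent]

lemma nabla_closed: "X \<in> VF \<Longrightarrow> Y \<in> VF \<Longrightarrow> nabla X Y \<in> VF"
  using levi_civita by (simp add: levi_civita_connection_def affine_connection_def)

lemma nabla_add_left:
  "X \<in> VF \<Longrightarrow> Y \<in> VF \<Longrightarrow> Z \<in> VF \<Longrightarrow> nabla (X + Y) Z = nabla X Z + nabla Y Z"
  and nabla_add_right:
  "X \<in> VF \<Longrightarrow> Y \<in> VF \<Longrightarrow> Z \<in> VF \<Longrightarrow> nabla X (Y + Z) = nabla X Y + nabla X Z"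
  using levi_civita by (simp_all add: levi_civita_connection_def affine_connection_def)

text \<open>The Leibniz rule for a constant function, whose derivative vanishes.\<close>

lemma nabla_scale_right:
  assumes X: "X \<in> VF" and Y: "Y \<in> VF"
  shows "nabla X (c *\<^sub>R Y) = c *\<^sub>R nabla X Y"
proof -
  have "nabla X (\<lambda>p. c *\<^sub>R Y p) = (\<lambda>p. X p (\<lambda>q. c) *\<^sub>R Y p + c *\<^sub>R nabla X Y p)"
    using levi_civita X Y smooth_functions_const[of c]
    unfolding levi_civita_connection_def affine_connection_def by fast
  moreover have "X p (\<lambda>q. c) = 0" for p
    using tangent_const[OF vector_fields_tangent[OF X]] .
  ultimately show ?thesis
    unfolding scaleR_fun_def[of c Y] scaleR_fun_def[of c "nabla X Y"]
    by simp
qed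

lemma torsion_free: "X \<in> VF \<Longrightarrow> Y \<in> VF \<Longrightarrow> lie_bracket A X Y = nabla X Y - nabla Y X"
  using levi_civita by (simp add: levi_civita_connection_def)

lemma metric_compatible:
  "X \<in> VF \<Longrightarrow> Y \<in> VF \<Longrightarrow> Z \<in> VF \<Longrightarrow>
    X p (\<lambda>q. g q (Y q) (Z q)) = g p (nabla X Y p) (Z p) + g p (Y p) (nabla X Z p)"
  using levi_civita by (simp add: levi_civita_connection_def)

lemma metric_smooth: "X \<in> VF \<Longrightarrow> Y \<in> VF \<Longrightarrow> (\<lambda>p. g p (X p) (Y p)) \<in> SF"
  using riemannian by (simp add: riemannian_metric_def)

lemma pull_metric:
  assumes "X \<in> VF" and "Y \<in> VF"
  shows "g p (pull a X p) (pull a Y p) = g (mul a p) (X (mul a p)) (Y (mul a p))"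
proof -
  have "g (mul (iv a) (mul a p)) (pull a X p) (pull a Y p) =
      g (mul a p) (X (mul a p)) (Y (mul a p))"
    using invariant assms[THEN vector_fields_tangent] unfolding left_invariant_def pull_def
    by blast
  then show ?thesis by simp
qed

text \<open>The right-hand side of the Koszul formula. It is built from the metric and the Lie
  bracket alone, both of which are natural under \<open>pull\<close>.\<close>

definition koszul :: "'a vfield \<Rightarrow> 'a vfield \<Rightarrow> 'a vfield \<Rightarrow> 'a \<Rightarrow> real" where
  "koszul X Y Z p =
    X p (\<lambda>q. g q (Y q) (Z q)) + Y p (\<lambda>q. g q (X q) (Z q)) - Z p (\<lambda>q. g q (X q) (Y q)) +
    g p (lie_bracket A X Y p) (Z p) - g p (lie_bracket A X Z p) (Y p) -
    g p (lie_bracket A Y Z p) (X p)"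

text \<open>Metric compatibility turns the three derivatives into six terms, vanishing torsion the
  three brackets into six more; all cancel except two copies of the left-hand product.\<close>

lemma koszul_formula:
  assumes V: "X \<in> VF" "Y \<in> VF" "Z \<in> VF"
  shows "2 * g p (nabla X Y p) (Z p) = koszul X Y Z p"
proof -
  have bracket: "g p (lie_bracket A S T p) (U p) = g p (nabla S T p) (U p) - g p (nabla T S p) (U p)"
    if "S \<in> VF" "T \<in> VF" "U \<in> VF" for S T U
    using that by (simp add: torsion_free g_diff_left vector_fields_tangent nabla_closed)
  have "g p (S p) (nabla T U p) = g p (nabla T U p) (S p)" if "S \<in> VF" "T \<in> VF" "U \<in> VF" for S T U
    using that by (simp add: g_commute vector_fields_tangent nabla_closed)
  then show ?thesis
    using V by (simp add: koszul_def metric_compatible bracket)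
qed

lemma lie_bracket_closed: "X \<in> VF \<Longrightarrow> Y \<in> VF \<Longrightarrow> lie_bracket A X Y \<in> VF"
  by (simp add: torsion_free nabla_closed real_vector.subspace_diff[OF subspace_vector_fields])

lemma koszul_pull:
  assumes V: "X \<in> VF" "Y \<in> VF" "Z \<in> VF"
  shows "koszul (pull a X) (pull a Y) (pull a Z) p = koszul X Y Z (mul a p)"
proof -
  have "pull a S p (\<lambda>q. g q (pull a T q) (pull a U q)) = S (mul a p) (\<lambda>q. g q (T q) (U q))"
    if "S \<in> VF" "T \<in> VF" "U \<in> VF" for S T U
    using pull_apply[OF metric_smooth[OF that(2,3), THEN smooth_functions_translate]] that
    by (simp add: pull_metric)
  then show ?thesis
    using V
    by (simp add: koszul_def pull_metric lie_bracket_closed flip: pull_lie_bracket)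
qed

text \<open>By the Koszul formula, the difference \<open>D\<close> of both sides is orthogonal to all pullbacks of vector
  fields, and \<open>D\<close> itself is such a pullback.\<close>

lemma pull_nabla:
  assumes X: "X \<in> VF" and Y: "Y \<in> VF"
  shows "pull a (nabla X Y) = nabla (pull a X) (pull a Y)"
proof
  fix p
  define D where "D = pull a (nabla X Y) - nabla (pull a X) (pull a Y)"
  have D: "D \<in> VF"
    using X Y unfolding D_def
    by (simp add: nabla_closed real_vector.subspace_diff[OF subspace_vector_fields])
  define Z where "Z = pull (iv a) D"
  have Z: "Z \<in> VF" "pull a Z = D"
    using D by (simp_all add: Z_def pull_pull_inverse)
  have "2 * g p (pull a (nabla X Y) p) (pull a Z p) =
      2 * g p (nabla (pull a X) (pull a Y) p) (pull a Z p)"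
    using X Y Z(1) by (simp add: pull_metric nabla_closed koszul_formula koszul_pull)
  then have eq: "g p (pull a (nabla X Y) p) (D p) = g p (nabla (pull a X) (pull a Y) p) (D p)"
    by (simp add: Z(2))
  have "g p (pull a (nabla X Y) p - nabla (pull a X) (pull a Y) p) (D p) = 0"
    using eq X Y D by (subst g_diff_left) (simp_all add: nabla_closed vector_fields_tangent)
  then have "g p (D p) (D p) = 0"
    by (simp add: D_def)
  moreover have "D p \<noteq> 0 \<longrightarrow> g p (D p) (D p) > 0"
    using inner_product_subspace.inner_product[OF inner_product_tangent]
      vector_fields_tangent[OF D]
    unfolding inner_product_on_def by blast
  ultimately have "D p = 0"
    by auto
  then show "pull a (nabla X Y) p = nabla (pull a X) (pull a Y) p"
    by (simp add: D_def)
qed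

lemma nabla_lie_algebra: "X \<in> LA \<Longrightarrow> Y \<in> LA \<Longrightarrow> nabla X Y \<in> LA"
  by (simp add: lie_algebra_iff_pull nabla_closed pull_nabla)

lemma lie_bracket_lie_algebra: "X \<in> LA \<Longrightarrow> Y \<in> LA \<Longrightarrow> lie_bracket A X Y \<in> LA"
  by (simp add: torsion_free nabla_lie_algebra real_vector.subspace_diff[OF subspace_lie_algebra])

lemma metric_form_constant:
  assumes "X \<in> LA" and "Y \<in> LA"
  shows "g p (X p) (Y p) = metric_form one g X Y"
  using pull_metric[of X Y one p] assms
  by (simp add: lie_algebra_pull metric_form_def)

text \<open>A left-invariant field is determined by its value at the identity. Positive definiteness
  of \<open>metric_form\<close> on fields depends on this.\<close>

lemma lie_algebra_eq_0:
  assumes "X \<in> LA" and "X one = 0"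
  shows "X = 0"
proof
  fix p
  have "X (mul p one) = differential A (mul p) (X one)"
    using assms(1) unfolding lie_algebra_def by blast
  then show "X p = 0 p"
    using assms(2) by (simp add: differential_def fun_eq_iff)
qed

lemma inner_product_lie_algebra: "inner_product_on LA (metric_form one g)"
proof -
  have ip: "inner_product_on (tangent_space A one) (g one)"
    using riemannian by (simp add: riemannian_metric_def)
  have T: "X one \<in> tangent_space A one" if "X \<in> LA" for X
    using that by (simp add: vector_fields_tangent)
  have "X one \<noteq> 0" if "X \<in> LA" "X \<noteq> 0" for X
    using lie_algebra_eq_0 that by blast
  then show ?thesis
    using ip T by (simp add: inner_product_on_def linear_on_def metric_form_def scaleR_fun_def)
qed

sublocale levi_civita_product LA "metric_form one g" nabla
proof
  show "subspace LA"
    by (rule subspace_lie_algebra)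
  show "inner_product_on LA (metric_form one g)"
    by (rule inner_product_lie_algebra)
next
  fix X Y Z assume LA: "X \<in> LA" "Y \<in> LA" "Z \<in> LA"
  \<comment> \<open>The product of two left-invariant fields is constant, so metric compatibility
    reduces to skewness of \<open>nabla X\<close>.\<close>
  have "X one (\<lambda>q. g q (Y q) (Z q)) = 0"
    using LA by (simp add: metric_form_constant tangent_const[OF vector_fields_tangent])
  then show "metric_form one g (nabla X Y) Z = - metric_form one g Y (nabla X Z)"
    using LA metric_compatible[of X Y Z one] by (simp add: metric_form_def)
  show "nabla X (nabla Y Z - nabla Z Y) - nabla (nabla Y Z - nabla Z Y) X +
      (nabla Y (nabla Z X - nabla X Z) - nabla (nabla Z X - nabla X Z) Y) +
      (nabla Z (nabla X Y - nabla Y X) - nabla (nabla X Y - nabla Y X) Z) = 0"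
    using jacobi_identity[of X Y Z] LA lie_bracket_closed[of Y Z] lie_bracket_closed[of Z X]
      lie_bracket_closed[of X Y]
    by (simp add: torsion_free)
qed (simp_all add: nabla_lie_algebra nabla_add_left nabla_add_right nabla_scale_right)

lemma ricci_form_eq_ric:
  assumes "X \<in> LA" and "Y \<in> LA"
  shows "ricci_form mul A nabla X Y = ric X Y"
  unfolding ricci_form_def ric_def
  by (rule trace_on_cong[OF subspace_lie_algebra])
    (use assms in \<open>simp add: curvature_def curv_def torsion_free\<close>)

lemma ricci_operator:
  assumes "X \<in> LA"
  shows "ricci_operator mul one A g nabla X \<in> LA"
    and "Y \<in> LA \<Longrightarrow>
      metric_form one g (ricci_operator mul one A g nabla X) Y = ricci_form mul A nabla X Y"
proof -
  have "\<exists>!Z. Z \<in> LA \<and> (\<forall>Y\<in>LA. ricci_form mul A nabla X Y = metric_form one g Z Y)"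
    using ric_representable[OF assms] assms by (simp add: ricci_form_eq_ric cong: ball_cong)
  from theI'[OF this]
  show "ricci_operator mul one A g nabla X \<in> LA"
    and "Y \<in> LA \<Longrightarrow>
      metric_form one g (ricci_operator mul one A g nabla X) Y = ricci_form mul A nabla X Y"
    unfolding ricci_operator_def by auto
qed

text \<open>Derivations are total functions constrained only on the Lie algebra, and it is only
  there that the Ricci operator can be compared with a given derivation.\<close>

lemma derivations_cong:
  assumes "D \<in> derivations mul A" and "\<And>X. X \<in> LA \<Longrightarrow> E X = D X"
  shows "E \<in> derivations mul A"
  using assms
  by (simp add: derivations_def linear_on_def lie_bracket_lie_algebra image_subset_iff)

lemma schouten_like_iff_algebraic_schouten_soliton:
  "schouten_like_metric mul one A g nabla \<longleftrightarrow> algebraic_schouten_soliton mul one A g nabla"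
proof
  let ?s = "scalar_curvature mul one A g nabla" and ?Ric = "ricci_operator mul one A g nabla"
  assume "schouten_like_metric mul one A g nabla"
  then obtain l0 c D where D: "D \<in> derivations mul A"
    and ric: "\<And>X Y. X \<in> LA \<Longrightarrow> Y \<in> LA \<Longrightarrow> ricci_form mul A nabla X Y =
        (?s * l0 + c) * metric_form one g X Y + metric_form one g (D X) Y"
    unfolding schouten_like_metric_def by blast
  have DL: "D X \<in> LA" if "X \<in> LA" for X
    using D that by (auto simp: derivations_def)
  have "?Ric X - (?s * l0 + c) *\<^sub>R X = D X" if X: "X \<in> LA" for X
  proof (rule ip_eqI)
    fix Y assume "Y \<in> LA"
    then show "metric_form one g (?Ric X - (?s * l0 + c) *\<^sub>R X) Y = metric_form one g (D X) Y"
      using X by (simp add: ip_diff_left ip_scale_left ricci_operator ric)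
  qed (use X DL ricci_operator(1) in auto)
  then have "(\<lambda>X. ?Ric X - (?s * l0 + c) *\<^sub>R X) \<in> derivations mul A"
    by (rule derivations_cong[OF D])
  then show "algebraic_schouten_soliton mul one A g nabla"
    unfolding algebraic_schouten_soliton_def by blast
next
  let ?s = "scalar_curvature mul one A g nabla" and ?Ric = "ricci_operator mul one A g nabla"
  assume "algebraic_schouten_soliton mul one A g nabla"
  then obtain l0 c where D: "(\<lambda>X. ?Ric X - (?s * l0 + c) *\<^sub>R X) \<in> derivations mul A"
    unfolding algebraic_schouten_soliton_def by blast
  define D where "D X = ?Ric X - (?s * l0 + c) *\<^sub>R X" for X
  have form: "metric_form one g (D X) Y =
      ricci_form mul A nabla X Y - (?s * l0 + c) * metric_form one g X Y"
    if "X \<in> LA" "Y \<in> LA" for X Y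
    using that by (simp add: D_def ip_diff_left ip_scale_left ricci_operator)
  have DL: "D X \<in> LA" if "X \<in> LA" for X
    using that by (simp add: D_def ricci_operator(1))
  \<comment> \<open>By \<open>form\<close>, this is a difference of two symmetric forms, the Ricci
    form and a multiple of the metric.\<close>
  have "metric_form one g (D X) Y = metric_form one g X (D Y)" if "X \<in> LA" "Y \<in> LA" for X Y
    using that ip_commute[of X "D Y"] ip_commute[of X Y]
    by (simp add: form DL ricci_form_eq_ric ric_commute[of X Y])
  then have "symmetric_wrt_metric mul one A g D"
    by (simp add: symmetric_wrt_metric_def)
  moreover have "D \<in> derivations mul A"
    using D by (simp add: D_def[abs_def])
  ultimately show "schouten_like_metric mul one A g nabla"
    unfolding schouten_like_metric_def using form
    by (intro exI[of _ l0] exI[of _ c] bexI[of _ D] conjI ballI) simp_all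
qed

end

theorem lemma1:
  fixes mul :: "'a::{t2_space, second_countable_topology} \<Rightarrow> 'a \<Rightarrow> 'a"
    and one :: 'a and iv :: "'a \<Rightarrow> 'a"
    and A :: "('a, 'v::real_normed_vector) atlas"
    and g :: "'a metric_tensor" and nabla :: "'a connection"
  assumes "lie_group mul one iv A"
    and "riemannian_metric A g" and "left_invariant mul A g"
    and "levi_civita_connection A g nabla"
  shows "schouten_like_metric mul one A g nabla \<longleftrightarrow> algebraic_schouten_soliton mul one A g nabla"
proof -
  interpret levi_civita_lie_group mul one iv A g nabla
    using assms by (simp add: levi_civita_lie_group_def levi_civita_lie_group_axioms_def)
  show ?thesis
    by (rule schouten_like_iff_algebraic_schouten_soliton)
qed

end
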